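(* Let $n\ge1$ be an integer, let $p,\lambda\in\mathbb{R}$ satisfy $1\le p<\lambda<n$, and let $p_2:=np/(\lambda-p)$. (a) For every $1\le q<p_2$ and all radially symmetric $C^1$ functions $u$ on $\overline{B_1(0)}$ vanishing on $\partial B_1(0)$, we have $$\|u\|_{L^q(B_1(0))}\le C\,\|\nabla u\|_{M^{p,\lambda}(B_1(0))},$$ where $C$ is a constant depending only on $n,p,\lambda$, and $q$. In addition, this embedding is false for $q\ge p_2$ (i.e., for $q\geq p_2$ there is no constant $C$ for which the inequality holds for all such $u$). (b) For all radially symmetric $C^1$ functions $u$ with compact support in $\mathbb{R}^n$, we have $$\|u\|_{L^{p_2}(\mathbb{R}^n)}\le C\,|||\nabla u|||_{p,\lambda;\mathbb{R}^n},$$ where $C$ is a constant depending only on $n,p$, and $\lambda$. In addition, $p_2$ is the optimal (largest) exponent in this inequality: for every $q>p_2$ there is no constant $C$ such that $\|u\|_{L^q(\mathbb{R}^n)}\le C\,|||\nabla u|||_{p,\lambda;\mathbb{R}^n}$ for all such $u$.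
   Context: $B_r(y)$ is the open ball in $\mathbb{R}^n$ of radius $r$ centered at $y$. For a domain $\Omega\subset\mathbb{R}^n$, the Morrey norm is $$\|\nabla u\|_{M^{p,\lambda}(\Omega)}^p:=\sup_{r>0,\,y\in\overline\Omega}\Big(r^{\lambda-n}\int_{\Omega\cap B_r(y)}|\nabla u(x)|^p\,dx\Big),$$ and the "triple norm" is $$|||\nabla u|||_{p,\lambda;\Omega}^p:=\sup_{y\in\overline\Omega}\int_\Omega|\nabla u(x)|^p\,|x-y|^{\lambda-n}\,dx.$$ *)

theory Defs
  imports "HOL-Analysis.Analysis"
begin

text \<open>
  All norms below take values in \<^typ>\<open>ennreal\<close>, so that no finiteness is presupposed: integrals
  are \<open>nn_integral\<close>s and suprema are taken in the complete lattice \<open>[0, \<infinity>]\<close>.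
\<close>

text \<open>Real power on \<open>[0, \<infinity>]\<close> with \<open>\<infinity> ^ a = \<infinity>\<close>; the intended range is \<open>a > 0\<close>.\<close>
definition enn_powr :: "ennreal \<Rightarrow> real \<Rightarrow> ennreal" where
  "enn_powr x a = (if x = \<infinity> then \<infinity> else ennreal (enn2real x powr a))"

definition grad :: "('a::real_inner \<Rightarrow> real) \<Rightarrow> 'a \<Rightarrow> 'a" where
  "grad u x = (THE D. GDERIV u x :> D)"

lemma grad_eq:
  assumes "GDERIV u x :> D"
  shows "grad u x = D"
  unfolding grad_def
proof (rule the_equality)
  fix E assume "GDERIV u x :> E"
  with assms have "(\<lambda>h. h \<bullet> D) = (\<lambda>h. h \<bullet> E)"
    unfolding gderiv_def by (rule has_derivative_unique)
  then show "E = D"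
    by (metis vector_eq_ldot)
qed (rule assms)

text \<open>
  \<open>u \<in> C\<^sup>1(closure \<Omega>)\<close> for open \<open>\<Omega>\<close>: \<open>u\<close> is differentiable in \<open>\<Omega>\<close>, and \<open>u\<close> and its gradient
  extend continuously to the closure. The values of \<open>u\<close> off the closure play no role.
  For \<open>\<Omega> = UNIV\<close> this is \<open>C\<^sup>1\<close> on the whole space.
\<close>
definition C1_closure :: "'a::real_inner set \<Rightarrow> ('a \<Rightarrow> real) \<Rightarrow> bool" where
  "C1_closure \<Omega> u \<longleftrightarrow> continuous_on (closure \<Omega>) u \<and>
     (\<exists>g. continuous_on (closure \<Omega>) g \<and> (\<forall>x\<in>\<Omega>. GDERIV u x :> g x))"

definition radial_on :: "'a::real_normed_vector set \<Rightarrow> ('a \<Rightarrow> real) \<Rightarrow> bool" where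
  "radial_on S u \<longleftrightarrow> (\<forall>x\<in>S. \<forall>y\<in>S. norm x = norm y \<longrightarrow> u x = u y)"

definition compact_support :: "('a::topological_space \<Rightarrow> real) \<Rightarrow> bool" where
  "compact_support u \<longleftrightarrow> compact (closure {x. u x \<noteq> 0})"

definition Lq_norm :: "real \<Rightarrow> 'a::euclidean_space set \<Rightarrow> ('a \<Rightarrow> real) \<Rightarrow> ennreal" where
  "Lq_norm q \<Omega> u = enn_powr (\<integral>\<^sup>+x\<in>\<Omega>. ennreal (\<bar>u x\<bar> powr q) \<partial>lborel) (1 / q)"

definition grad_morrey_norm ::
    "real \<Rightarrow> real \<Rightarrow> 'a::euclidean_space set \<Rightarrow> ('a \<Rightarrow> real) \<Rightarrow> ennreal" where
  "grad_morrey_norm p lam \<Omega> u =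
     enn_powr
       (SUP (r, y) \<in> {0<..} \<times> closure \<Omega>.
          ennreal (r powr (lam - real DIM('a))) *
          (\<integral>\<^sup>+x\<in>\<Omega> \<inter> ball y r. ennreal (norm (grad u x) powr p) \<partial>lborel))
       (1 / p)"

definition grad_triple_norm ::
    "real \<Rightarrow> real \<Rightarrow> 'a::euclidean_space set \<Rightarrow> ('a \<Rightarrow> real) \<Rightarrow> ennreal" where
  "grad_triple_norm p lam \<Omega> u =
     enn_powr
       (SUP y \<in> closure \<Omega>.
          \<integral>\<^sup>+x\<in>\<Omega>. ennreal (norm (grad u x) powr p * norm (x - y) powr (lam - real DIM('a))) \<partial>lborel)
       (1 / p)"

end

theory Submission
  imports Defs
begin

text \<open>
  A radial function \<open>u x = f |x|\<close> is controlled by the one-dimensional function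
  \<open>G s = \<integral>\<^sub>s\<^sup>R |f'|\<close>, which dominates \<open>|f|\<close> when \<open>f R = 0\<close> and, unlike \<open>|f|\<close>, is \<open>C\<^sup>1\<close> and
  nonincreasing. Both norms of \<open>\<nabla>u\<close> are suprema over centres \<open>y\<close>; evaluated at \<open>y = 0\<close> in polar
  coordinates they bound weighted energies \<open>\<integral> |f'|\<^sup>p s\<^sup>a\<^sup>+\<^sup>p\<^sup>-\<^sup>1 ds\<close>, and these bound \<open>u\<close>.
  (The Morrey exponent \<open>\<lambda>\<close> is \<open>lam\<close> in the formal text; \<open>n\<close> is the dimension.)

  One differential inequality drives everything. For \<open>a > 0\<close>,
  \<open>(G\<^sup>p s\<^sup>a)' = a G\<^sup>p s\<^sup>a\<^sup>-\<^sup>1 - p G\<^sup>p\<^sup>-\<^sup>1 |f'| s\<^sup>a \<ge> (a/2) G\<^sup>p s\<^sup>a\<^sup>-\<^sup>1 - C |f'|\<^sup>p s\<^sup>a\<^sup>+\<^sup>p\<^sup>-\<^sup>1\<close>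
  (\<open>weighted_tail_deriv\<close>). Dropping the good term and integrating from \<open>r\<close> to \<open>R\<close> gives the decay
  \<open>G(r)\<^sup>p r\<^sup>a \<le> C \<integral> |f'|\<^sup>p s\<^sup>a\<^sup>+\<^sup>p\<^sup>-\<^sup>1\<close> (\<open>tail_pointwise_bound\<close>); keeping it and integrating from \<open>0\<close>
  gives Hardy's inequality for \<open>\<integral> G\<^sup>p s\<^sup>a\<^sup>-\<^sup>1\<close> (\<open>hardy_inequality\<close>).

  For the triple norm take \<open>a = \<lambda> - p\<close>. At the exponent \<open>q = np/(\<lambda>-p)\<close> the integrand
  \<open>G\<^sup>q s\<^sup>n\<^sup>-\<^sup>1\<close> is the product of the power \<open>q/p - 1\<close> of the decaying quantity \<open>G\<^sup>p s\<^sup>a\<close> and the Hardy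
  integrand \<open>G\<^sup>p s\<^sup>a\<^sup>-\<^sup>1\<close>, so the two estimates multiply to the \<open>L\<^sup>q\<close> bound. For the Morrey norm the energy
  with exponent \<open>\<lambda>\<close> may diverge logarithmically; but a partial integration bounds the energy for every
  exponent \<open>\<mu> > \<lambda>\<close> (\<open>morrey_tail_bound\<close>), whence \<open>|u x| \<le> C |x|\<close> to the power \<open>-(\<mu>-p)/p\<close>. Since
  \<open>q < np/(\<lambda>-p)\<close> is strict, \<open>\<mu>\<close> can be chosen so close to \<open>\<lambda>\<close> that this is \<open>q\<close>-integrable.

  For the sharpness of the Morrey embedding, put \<open>\<beta> = (\<lambda>-p)/p\<close> and regularise \<open>|x|\<^sup>-\<^sup>\<beta> - 1\<close> by
  replacing \<open>|x|\<^sup>2\<close> by \<open>|x|\<^sup>2 + \<epsilon>\<^sup>2\<close>. The gradients satisfy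
  \<open>|\<nabla>u|\<^sup>p \<le> C |x|\<close> to the power \<open>-\<lambda>\<close>, whose Morrey norm is finite, while the integral of
  \<open>|u|\<^sup>q\<close> grows at least like \<open>ln (1/\<epsilon>)\<close>. For the triple norm, a bump function dilated to radius
  \<open>R\<close> has triple norm at most a constant times \<open>R\<^sup>\<beta>\<close> and \<open>L\<^sup>q\<close> norm at least a constant times
  \<open>R\<close> to the power \<open>n/q\<close>; if \<open>q > n/\<beta>\<close>, letting \<open>R \<rightarrow> 0\<close> excludes any constant.
\<close>

section \<open>Powers on the extended half-line\<close>

lemma enn_powr_ennreal: "0 \<le> t \<Longrightarrow> enn_powr (ennreal t) a = ennreal (t powr a)"
  by (simp add: enn_powr_def)

lemma enn_powr_mono:
  assumes "x \<le> y" "0 \<le> a"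
  shows "enn_powr x a \<le> enn_powr y a"
proof (cases y)
  case (real t)
  with assms obtain s where "x = ennreal s" "0 \<le> s" "s \<le> t"
    by (cases x) (auto simp: top_unique)
  with real assms show ?thesis by (auto simp: enn_powr_ennreal intro!: ennreal_leI powr_mono2)
qed (simp add: enn_powr_def)

lemma enn_powr_le_iff:
  assumes "0 < q" "0 \<le> D"
  shows "enn_powr x (1 / q) \<le> ennreal D \<longleftrightarrow> x \<le> ennreal (D powr q)"
proof (cases x)
  case (real t)
  have "t powr (1 / q) \<le> D \<longleftrightarrow> t \<le> D powr q"
  proof
    assume "t powr (1 / q) \<le> D"
    then have "(t powr (1 / q)) powr q \<le> D powr q" using assms by (intro powr_mono2) auto
    then show "t \<le> D powr q" using assms real by (simp add: powr_powr)
  next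
    assume "t \<le> D powr q"
    then have "t powr (1 / q) \<le> (D powr q) powr (1 / q)" using assms real by (intro powr_mono2) auto
    then show "t powr (1 / q) \<le> D" using assms real by (simp add: powr_powr)
  qed
  with real assms show ?thesis by (simp add: enn_powr_ennreal)
next
  case top
  then show ?thesis by (simp add: enn_powr_def top_unique)
qed

text \<open>
  The form in which every norm estimate below is proved: the norms are removed, and only the case of
  a finite right-hand side remains, as an inequality between integrals that is homogeneous of degree \<open>q/p\<close>.
\<close>

lemma enn_powr_le_mult:
  assumes "0 < q" "0 < p" "0 < K"
    and bound: "\<And>t. 0 \<le> t \<Longrightarrow> Y = ennreal t \<Longrightarrow> X \<le> ennreal (K * t powr (q / p))"
  shows "enn_powr X (1 / q) \<le> ennreal (K powr (1 / q)) * enn_powr Y (1 / p)"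
proof (cases Y)
  case (real t)
  have *: "K * t powr (q / p) = (K powr (1 / q) * t powr (1 / p)) powr q"
    using assms real by (simp add: powr_mult powr_powr)
  have "enn_powr X (1 / q) \<le> ennreal (K powr (1 / q) * t powr (1 / p))"
    unfolding enn_powr_le_iff[OF \<open>0 < q\<close> mult_nonneg_nonneg[OF powr_ge_zero powr_ge_zero]]
    using bound[of t] real unfolding * by simp
  then show ?thesis using real by (simp add: enn_powr_ennreal ennreal_mult)
next
  case top
  then show ?thesis using assms by (simp add: enn_powr_def ennreal_mult_top)
qed

section \<open>Polar coordinates and power weights\<close>

definition unit_sphere_area :: "nat \<Rightarrow> real" where
  "unit_sphere_area n = real n * unit_ball_vol (real n)"

lemma unit_sphere_area_pos: "0 < n \<Longrightarrow> 0 < unit_sphere_area n"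
  by (simp add: unit_sphere_area_def)

text \<open>
  Polar coordinates for radial integrands: the distribution of \<open>|x|\<close> under Lebesgue measure is determined by the volumes of the balls around \<open>0\<close>, and these are the integrals of
  the density on the right.
\<close>

lemma distr_norm_lborel:
  "distr lborel borel (norm :: 'a::euclidean_space \<Rightarrow> real) =
   density lborel (\<lambda>s. ennreal (unit_sphere_area DIM('a) * s powr (real DIM('a) - 1)) * indicator {0..} s)"
    (is "?M = ?N")
proof (rule measure_eqI_generator_eq)
  let ?n = "DIM('a)"
  show "Int_stable (range (atMost :: real \<Rightarrow> real set))"
    by (auto simp: Int_stable_def)
  show "sets ?M = sigma_sets UNIV (range atMost)" "sets ?N = sigma_sets UNIV (range atMost)"
    by (simp_all add: borel_eq_atMost image_def) 
  have M: "emeasure ?M {..r} = ennreal (unit_ball_vol ?n * r ^ ?n)" if "0 \<le> r" for r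
  proof -
    have "emeasure ?M {..r} = emeasure lborel (cball (0::'a) r)"
      by (subst emeasure_distr) (auto intro!: arg_cong[where f = "emeasure lborel"])
    then show ?thesis using that by (simp add: emeasure_cball)
  qed
  have M0: "emeasure ?M {..r} = 0" if "r < 0" for r
  proof -
    have "norm -` {..r} = ({} :: 'a set)"
      using that by (auto dest: order_trans[OF norm_ge_zero])
    then show ?thesis by (subst emeasure_distr) auto
  qed
  have N: "emeasure ?N {..r} = ennreal (unit_ball_vol ?n * r ^ ?n)" if "0 \<le> r" for r
  proof -
    have "((\<lambda>s. s powr (real ?n - 1)) has_integral r powr (real ?n - 1 + 1) / (real ?n - 1 + 1)) {0..r}"
      using that DIM_positive[where 'a='a] by (intro has_integral_powr_from_0) auto
    from has_integral_mult_right[OF this, of "unit_sphere_area ?n"]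
    have I: "((\<lambda>s. unit_sphere_area ?n * s powr (real ?n - 1)) has_integral unit_ball_vol ?n * r ^ ?n) {0..r}"
      using that by (simp add: unit_sphere_area_def powr_realpow')
    have "emeasure ?N {..r} =
      (\<integral>\<^sup>+s. ennreal (unit_sphere_area ?n * s powr (real ?n - 1)) * indicator {0..r} s \<partial>lborel)"
      by (subst emeasure_density) (auto intro!: nn_integral_cong simp: indicator_def)
    also have "\<dots> = ennreal (unit_ball_vol ?n * r ^ ?n)"
      using I by (intro nn_integral_has_integral_lebesgue')
        (auto simp: unit_sphere_area_def)
    finally show ?thesis .
  qed
  have N0: "emeasure ?N {..r} = 0" if "r < 0" for r
    using that by (subst emeasure_density) (simp_all add: nn_integral_0_iff_AE indicator_def)
  show "emeasure ?M X = emeasure ?N X" if "X \<in> range atMost" for X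
    using that M N M0 N0 by (auto simp: not_le) (metis not_le)
  show "range (\<lambda>i. {..real i}) \<subseteq> range atMost" by auto
  show "(\<Union>i. {..real i}) = UNIV" using real_arch_simple by auto
  show "emeasure ?M {..real i} \<noteq> \<infinity>" for i using M[of "real i"] by simp
qed auto

lemma nn_integral_radial:
  assumes [measurable]: "\<phi> \<in> borel_measurable borel"
  shows "(\<integral>\<^sup>+x. \<phi> (norm (x::'a::euclidean_space)) \<partial>lborel) =
    ennreal (unit_sphere_area DIM('a)) *
      (\<integral>\<^sup>+s. ennreal (s powr (real DIM('a) - 1)) * \<phi> s * indicator {0..} s \<partial>lborel)"
proof -
  have "(\<integral>\<^sup>+x. \<phi> (norm (x::'a)) \<partial>lborel) = (\<integral>\<^sup>+s. \<phi> s \<partial>distr lborel borel (norm :: 'a \<Rightarrow> real))"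
    by (subst nn_integral_distr) auto
  also have "\<dots> = (\<integral>\<^sup>+s. ennreal (unit_sphere_area DIM('a)) *
      (ennreal (s powr (real DIM('a) - 1)) * \<phi> s * indicator {0..} s) \<partial>lborel)"
    unfolding distr_norm_lborel
    by (subst nn_integral_density)
      (auto intro!: nn_integral_cong simp: ennreal_mult unit_sphere_area_def indicator_def mult_ac)
  also have "\<dots> = ennreal (unit_sphere_area DIM('a)) *
      (\<integral>\<^sup>+s. ennreal (s powr (real DIM('a) - 1)) * \<phi> s * indicator {0..} s \<partial>lborel)"
    by (rule nn_integral_cmult) auto
  finally show ?thesis .
qed

lemma nn_integral_norm_powr_ball_0:
  assumes "\<nu> < real DIM('a::euclidean_space)" "0 \<le> r"
  shows "(\<integral>\<^sup>+x\<in>ball (0::'a) r. ennreal (norm x powr - \<nu>) \<partial>lborel) \<le>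
    ennreal (unit_sphere_area DIM('a) / (real DIM('a) - \<nu>) * r powr (real DIM('a) - \<nu>))"
proof -
  let ?n = "real DIM('a)"
  have "(\<integral>\<^sup>+x\<in>ball (0::'a) r. ennreal (norm x powr - \<nu>) \<partial>lborel) =
    (\<integral>\<^sup>+x. ennreal (norm (x::'a) powr - \<nu>) * indicator {..<r} (norm x) \<partial>lborel)"
    by (intro nn_integral_cong) (auto simp: indicator_def)
  also have "\<dots> = ennreal (unit_sphere_area DIM('a)) * (\<integral>\<^sup>+s. ennreal (s powr (?n - 1)) *
      (ennreal (s powr - \<nu>) * indicator {..<r} s) * indicator {0..} s \<partial>lborel)"
    by (rule nn_integral_radial) auto
  also have "\<dots> \<le> ennreal (unit_sphere_area DIM('a)) *
      (\<integral>\<^sup>+s. ennreal (s powr (?n - \<nu> - 1)) * indicator {0..r} s \<partial>lborel)"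
    by (intro mult_left_mono nn_integral_mono)
      (auto simp: indicator_def ennreal_mult[symmetric] powr_add[symmetric] algebra_simps)
  also have "(\<integral>\<^sup>+s. ennreal (s powr (?n - \<nu> - 1)) * indicator {0..r} s \<partial>lborel) =
      ennreal (r powr (?n - \<nu> - 1 + 1) / (?n - \<nu> - 1 + 1))"
    using assms by (intro nn_integral_has_integral_lebesgue' has_integral_powr_from_0) auto
  finally show ?thesis
    using assms by (simp add: ennreal_mult[symmetric] unit_sphere_area_def)
qed

text \<open>
  The first summand comes from integrating \<open>|x|\<close> to the power \<open>-\<nu>\<close> over the unit ball around \<open>0\<close>, the second
  from the points outside it, where the weight is at most \<open>1\<close>.
\<close>

definition riesz_const :: "nat \<Rightarrow> real \<Rightarrow> real" where
  "riesz_const n \<nu> = unit_sphere_area n / (real n - \<nu>) + unit_ball_vol (real n)"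

lemma riesz_const_pos:
  assumes "\<nu> < real n"
  shows "0 < riesz_const n \<nu>"
  unfolding riesz_const_def using assms
  by (intro add_nonneg_pos) (auto simp: unit_sphere_area_def)

text \<open>
  The centre \<open>y\<close> does not matter: on the part of the ball where \<open>|x| < r\<close> compare with the ball around
  \<open>0\<close>, and on the rest the weight is at most \<open>r\<close> to the power \<open>-\<nu>\<close>. This bounds the Morrey norm of the
  gradients in one counterexample (\<open>\<nu> = \<lambda>\<close>) and, after a translation, the triple norm in the other
  (\<open>\<nu> = n - \<lambda>\<close>).
\<close>

lemma nn_integral_norm_powr_ball:
  fixes y :: "'a::euclidean_space"
  assumes "0 \<le> \<nu>" "\<nu> < real DIM('a)" "0 < r"
  shows "(\<integral>\<^sup>+x\<in>ball y r. ennreal (norm x powr - \<nu>) \<partial>lborel) \<le>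
    ennreal (riesz_const DIM('a) \<nu> * r powr (real DIM('a) - \<nu>))"
proof -
  let ?n = "real DIM('a)"
  have [measurable]: "ball (0::'a) r \<in> sets borel" "ball y r \<in> sets borel" by simp_all
  have "(\<integral>\<^sup>+x\<in>ball y r. ennreal (norm x powr - \<nu>) \<partial>lborel) \<le>
    (\<integral>\<^sup>+x. ennreal (norm x powr - \<nu>) * indicator (ball 0 r) x + ennreal (r powr - \<nu>) * indicator (ball y r) x \<partial>lborel)"
    using assms
    by (intro nn_integral_mono) (auto simp: indicator_def not_less intro!: ennreal_leI powr_mono2')
  also have "\<dots> = (\<integral>\<^sup>+x\<in>ball (0::'a) r. ennreal (norm x powr - \<nu>) \<partial>lborel) +
      ennreal (r powr - \<nu>) * emeasure lborel (ball y r)"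
    by (subst nn_integral_add) (measurable, simp add: nn_integral_cmult_indicator)
  also have "\<dots> \<le> ennreal (unit_sphere_area DIM('a) / (?n - \<nu>) * r powr (?n - \<nu>)) +
      ennreal (r powr - \<nu>) * ennreal (unit_ball_vol ?n * r ^ DIM('a))"
    by (intro add_mono nn_integral_norm_powr_ball_0 mult_left_mono)
      (use assms in \<open>simp_all add: emeasure_ball\<close>)
  also have "\<dots> = ennreal (riesz_const DIM('a) \<nu> * r powr (?n - \<nu>))"
  proof -
    have "r powr - \<nu> * r ^ DIM('a) = r powr (?n - \<nu>)"
      using assms by (simp add: powr_diff powr_minus_divide powr_realpow)
    then show ?thesis
      using assms by (simp add: riesz_const_def ennreal_mult[symmetric] ennreal_plus[symmetric]
          unit_sphere_area_def distrib_right mult.left_commute del: ennreal_plus)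
  qed
  finally show ?thesis .
qed

section \<open>The weighted inequalities on the half-line\<close>

definition hardy_const :: "real \<Rightarrow> real \<Rightarrow> real" where
  "hardy_const p a = p * (2 * p / a) powr (p - 1)"

lemma hardy_const_pos: "1 \<le> p \<Longrightarrow> 0 < a \<Longrightarrow> 0 < hardy_const p a"
  by (simp add: hardy_const_def)

text \<open>
  Young's inequality with a small parameter, by distinction of cases: either \<open>p y\<close> is at most \<open>(a/2) g\<close>,
  and the product is absorbed by the first term, or \<open>g\<close> is at most a multiple of \<open>y\<close>.
  The argument is uniform in \<open>p\<close> down to \<open>p = 1\<close>.
\<close>

lemma young_absorb:
  assumes "1 \<le> p" "0 < a" "0 < g" "0 \<le> y"
  shows "p * g powr (p - 1) * y \<le> a / 2 * g powr p + hardy_const p a * y powr p"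
proof (cases "p * y \<le> a / 2 * g")
  case True
  have "p * g powr (p - 1) * y = g powr (p - 1) * (p * y)" by simp
  also have "\<dots> \<le> g powr (p - 1) * (a / 2 * g)" using True by (intro mult_left_mono) auto
  also have "\<dots> = a / 2 * g powr p" using assms by (simp add: powr_diff)
  finally show ?thesis using assms hardy_const_pos[of p a] by (simp add: add_increasing2)
next
  case False
  then have y: "0 < y" using assms by (cases "y = 0") auto
  have "g \<le> 2 * p / a * y" using False assms by (simp add: field_simps)
  then have "g powr (p - 1) \<le> (2 * p / a * y) powr (p - 1)" using assms by (intro powr_mono2) auto
  then have "p * g powr (p - 1) * y \<le> p * (2 * p / a * y) powr (p - 1) * y"
    using assms by (intro mult_right_mono mult_left_mono) auto
  also have "\<dots> = hardy_const p a * y powr p"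
  proof -
    have "(2 * p / a * y) powr (p - 1) = (2 * p / a) powr (p - 1) * y powr (p - 1)"
      using assms by (subst powr_mult) auto
    moreover have "y powr (p - 1) * y = y powr p" using y by (simp add: powr_diff)
    ultimately show ?thesis by (simp add: hardy_const_def)
  qed
  finally show ?thesis using assms by (simp add: add_increasing)
qed

text \<open>
  A \<open>C\<^sup>1\<close> majorant of \<open>|f|\<close> for every \<open>f\<close> with \<open>f' = h\<close> and \<open>f R = 0\<close>. Using it in place of \<open>|f|\<close>
  avoids the zeros of \<open>f\<close>, where \<open>|f|\<close> need not be differentiable.
\<close>

definition tail :: "(real \<Rightarrow> real) \<Rightarrow> real \<Rightarrow> real \<Rightarrow> real" where
  "tail h R s = integral {s..R} (\<lambda>t. \<bar>h t\<bar>)"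

text \<open>
  For \<open>f' = h\<close> and \<open>a = \<lambda> - p\<close> this is, up to the area of the unit sphere, the integral of
  \<open>|\<nabla>u|\<^sup>p\<close> over the ball of radius \<open>s\<close> with the weight \<open>|x|\<close> to the power \<open>\<lambda> - n\<close>; for \<open>a = n - p\<close> the
  weight is \<open>1\<close>.
\<close>

definition energy :: "(real \<Rightarrow> real) \<Rightarrow> real \<Rightarrow> real \<Rightarrow> real \<Rightarrow> real" where
  "energy h p a s = integral {0..s} (\<lambda>t. \<bar>h t\<bar> powr p * t powr (a + p - 1))"

lemma tail_nonneg: "0 \<le> tail h R s"
  unfolding tail_def by (cases "(\<lambda>t. \<bar>h t\<bar>) integrable_on {s..R}")
    (auto intro: integral_nonneg simp: not_integrable_integral)

lemma tail_end [simp]: "tail h R R = 0"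
  by (simp add: tail_def)

lemma energy_0 [simp]: "energy h p a 0 = 0"
  by (simp add: energy_def)

lemma energy_nonneg: "0 \<le> energy h p a s"
  unfolding energy_def
  by (cases "(\<lambda>t. \<bar>h t\<bar> powr p * t powr (a + p - 1)) integrable_on {0..s}")
    (auto intro: integral_nonneg simp: not_integrable_integral)

context
  fixes h :: "real \<Rightarrow> real" and R :: real
  assumes cont_h: "continuous_on {0..R} h"
begin

lemma tail_has_derivative:
  assumes "s \<in> {0<..<R}"
  shows "(tail h R has_real_derivative - \<bar>h s\<bar>) (at s)"
proof -
  have "continuous_on {0..R} (\<lambda>t. \<bar>h t\<bar>)" using cont_h by (intro continuous_intros)
  from integral_has_real_derivative'[OF this, of s] assms
  have "(tail h R has_real_derivative - \<bar>h s\<bar>) (at s within {0..R})"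
    by (simp add: tail_def[abs_def])
  moreover have "at s within {0..R} = at s"
    using assms by (intro at_within_interior) (auto simp: interior_atLeastAtMost_real)
  ultimately show ?thesis by simp
qed

lemma continuous_on_tail: "continuous_on {0..R} (tail h R)"
proof -
  have "continuous_on {0..R} (\<lambda>t. \<bar>h t\<bar>)" using cont_h by (intro continuous_intros)
  from integral_has_real_derivative'[OF this]
  show ?thesis unfolding tail_def[abs_def]
    by (meson DERIV_isCont continuous_on_eq_continuous_within has_field_derivative_def has_derivative_continuous)
qed

end

context
  fixes h :: "real \<Rightarrow> real" and R p a :: real
  assumes cont_h: "continuous_on {0..R} h" and R: "0 < R" and p: "1 \<le> p" and a: "0 < a"
begin

text \<open>
  The term of the derivative that contains \<open>|h|\<close> is absorbed by half of the other term, at the price of the energy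
  density. The positive \<open>\<epsilon>\<close> keeps the base of the power away from \<open>0\<close>, so that the power is
  differentiable.
\<close>

lemma weighted_tail_deriv:
  assumes "0 < \<epsilon>" "s \<in> {0<..<R}"
  shows "\<exists>D. ((\<lambda>s. (\<epsilon> + tail h R s) powr p * s powr a) has_real_derivative D) (at s) \<and>
    a / 2 * ((\<epsilon> + tail h R s) powr p * s powr (a - 1))
      \<le> D + hardy_const p a * (\<bar>h s\<bar> powr p * s powr (a + p - 1))"
proof -
  let ?g = "\<epsilon> + tail h R s"
  have g: "0 < ?g" using assms tail_nonneg[of h R s] by simp
  have s: "0 < s" using assms by simp
  define D where "D = (p * ?g powr (p - 1) * (- \<bar>h s\<bar>)) * s powr a + ?g powr p * (a * s powr (a - 1))"
  have "((\<lambda>s. (\<epsilon> + tail h R s) powr p) has_real_derivative (p * ?g powr (p - 1) * (- \<bar>h s\<bar>))) (at s)"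
    using g DERIV_chain2[OF has_real_derivative_powr DERIV_add[OF DERIV_const tail_has_derivative[OF cont_h]], of \<epsilon> s p] assms by simp
  from DERIV_mult[OF this has_real_derivative_powr[OF s]]
  have D: "((\<lambda>s. (\<epsilon> + tail h R s) powr p * s powr a) has_real_derivative D) (at s)"
    by (simp add: D_def mult_ac add_ac)
  let ?X = "p * ?g powr (p - 1) * \<bar>h s\<bar> * s powr a" and ?Y = "a / 2 * (?g powr p * s powr (a - 1))"
    and ?Z = "hardy_const p a * (\<bar>h s\<bar> powr p * s powr (a + p - 1))"
  have "s * s powr (a - 1) = s powr a" using s by (simp add: powr_diff)
  then have "?X = p * ?g powr (p - 1) * (\<bar>h s\<bar> * s) * s powr (a - 1)"
    by (metis mult.assoc)
  also have "\<dots> \<le> (a / 2 * ?g powr p + hardy_const p a * (\<bar>h s\<bar> * s) powr p) * s powr (a - 1)"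
    using s g p a by (intro mult_right_mono young_absorb) auto
  also have "\<dots> = ?Y + ?Z"
  proof -
    have "(\<bar>h s\<bar> * s) powr p * s powr (a - 1) = \<bar>h s\<bar> powr p * s powr (a + p - 1)"
      using s by (simp add: powr_mult powr_add[symmetric] algebra_simps)
    then show ?thesis by (simp add: distrib_right mult.assoc)
  qed
  finally have "?X \<le> ?Y + ?Z" .
  moreover have "D = 2 * ?Y - ?X" by (simp add: D_def)
  ultimately have "?Y \<le> D + ?Z" by linarith
  with D show ?thesis by blast
qed

lemma continuous_on_weighted_tail:
  assumes "0 < \<epsilon>"
  shows "continuous_on {0..R} (\<lambda>s. (\<epsilon> + tail h R s) powr p * s powr a)"
  using assms a p tail_nonneg
  by (intro continuous_intros continuous_on_powr' continuous_on_tail[OF cont_h])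
    (auto simp: add_nonneg_eq_0_iff less_imp_le add_nonneg_nonneg)

text \<open>
  \<open>(\<epsilon> + tail)\<^sup>p s\<^sup>a + C E\<close> is nondecreasing, and at \<open>R\<close> the tail vanishes. Any \<open>E\<close> that grows at least as fast
  as the energy is admitted, because the Morrey bound is applied to an antiderivative obtained by parts
  and not to the energy itself.
\<close>

lemma tail_pointwise_bound:
  assumes r: "r \<in> {0<..R}"
    and contE: "continuous_on {r..R} E"
    and derE: "\<And>s. s \<in> {r<..<R} \<Longrightarrow>
      \<exists>D. (E has_real_derivative D) (at s) \<and> \<bar>h s\<bar> powr p * s powr (a + p - 1) \<le> D"
  shows "tail h R r powr p * r powr a \<le> hardy_const p a * (E R - E r)"
proof (rule field_le_epsilon)
  fix e :: real assume e: "0 < e"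
  \<comment> \<open>The tail vanishes at \<open>R\<close>, so \<open>\<epsilon>\<close> leaves there the boundary term \<open>\<epsilon>\<^sup>p R\<^sup>a\<close>, made equal to \<open>e\<close>.\<close>
  define \<epsilon> where "\<epsilon> = (e / R powr a) powr (1 / p)"
  have \<epsilon>: "0 < \<epsilon>" "\<epsilon> powr p * R powr a = e" using e R p by (auto simp: \<epsilon>_def powr_powr)
  let ?H = "\<lambda>s. (\<epsilon> + tail h R s) powr p * s powr a + hardy_const p a * E s"
  have "?H r \<le> ?H R"
  proof (rule DERIV_nonneg_imp_increasing_open[where f = ?H and a = r and b = R])
    show "r \<le> R" using r by simp
    show "continuous_on {r..R} ?H"
      using r contE by (intro continuous_intros continuous_on_subset[OF continuous_on_weighted_tail] \<epsilon>) auto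
    fix s assume s: "r < s" "s < R"
    obtain D where D: "((\<lambda>s. (\<epsilon> + tail h R s) powr p * s powr a) has_real_derivative D) (at s)"
      "a / 2 * ((\<epsilon> + tail h R s) powr p * s powr (a - 1))
        \<le> D + hardy_const p a * (\<bar>h s\<bar> powr p * s powr (a + p - 1))"
      using weighted_tail_deriv[OF \<epsilon>(1), of s] s r by auto
    obtain D' where D': "(E has_real_derivative D') (at s)" "\<bar>h s\<bar> powr p * s powr (a + p - 1) \<le> D'"
      using derE[of s] s by auto
    have "0 \<le> a / 2 * ((\<epsilon> + tail h R s) powr p * s powr (a - 1))" using a by simp
    moreover have "hardy_const p a * (\<bar>h s\<bar> powr p * s powr (a + p - 1)) \<le> hardy_const p a * D'"
      using D'(2) hardy_const_pos[OF p a] by (intro mult_left_mono) auto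
    ultimately have "0 \<le> D + hardy_const p a * D'" using D(2) by linarith
    moreover have "(?H has_real_derivative D + hardy_const p a * D') (at s)"
      using D(1) D'(1) by (intro DERIV_add DERIV_cmult)
    ultimately show "\<exists>y. (?H has_real_derivative y) (at s) \<and> 0 \<le> y" by blast
  qed
  moreover have "tail h R r powr p * r powr a \<le> (\<epsilon> + tail h R r) powr p * r powr a"
    using \<epsilon> p tail_nonneg by (intro mult_right_mono powr_mono2) auto
  ultimately show "tail h R r powr p * r powr a \<le> hardy_const p a * (E R - E r) + e"
    using \<epsilon>(2) by (simp add: right_diff_distrib)
qed

lemma continuous_on_energy_density:
  "continuous_on {0..R} (\<lambda>t. \<bar>h t\<bar> powr p * t powr (a + p - 1))"
  using p a by (intro continuous_intros continuous_on_powr' cont_h) auto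

lemma continuous_on_energy: "continuous_on {0..R} (energy h p a)"
  unfolding energy_def[abs_def]
  by (intro indefinite_integral_continuous_1 integrable_continuous_real continuous_on_energy_density)

lemma energy_has_derivative:
  assumes "s \<in> {0<..<R}"
  shows "(energy h p a has_real_derivative \<bar>h s\<bar> powr p * s powr (a + p - 1)) (at s)"
proof -
  from integral_has_real_derivative[OF continuous_on_energy_density, of s] assms
  have "(energy h p a has_real_derivative \<bar>h s\<bar> powr p * s powr (a + p - 1)) (at s within {0..R})"
    by (simp add: energy_def[abs_def])
  moreover have "at s within {0..R} = at s"
    using assms by (intro at_within_interior) (auto simp: interior_atLeastAtMost_real)
  ultimately show ?thesis by simp
qed

lemma tail_le_energy:
  assumes "r \<in> {0<..R}"
  shows "tail h R r powr p * r powr a \<le> hardy_const p a * energy h p a R"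
proof -
  have "tail h R r powr p * r powr a \<le> hardy_const p a * (energy h p a R - energy h p a r)"
    using assms
    by (intro tail_pointwise_bound continuous_on_subset[OF continuous_on_energy])
      (auto intro!: exI energy_has_derivative)
  also have "\<dots> \<le> hardy_const p a * energy h p a R"
    using hardy_const_pos[OF p a] energy_nonneg[of h p a r] by (intro mult_left_mono) auto
  finally show ?thesis .
qed

text \<open>
  The same monotone quantity as for the pointwise bound, but now the good term \<open>(a/2) G\<^sup>p s\<^sup>a\<^sup>-\<^sup>1\<close> of its derivative
  is kept and integrated over the whole interval. The boundary value at \<open>0\<close> vanishes because \<open>a > 0\<close>.
\<close>

lemma hardy_inequality:
  "(\<integral>\<^sup>+s\<in>{0..R}. ennreal (tail h R s powr p * s powr (a - 1)) \<partial>lborel) \<le>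
    ennreal (2 / a * (hardy_const p a * energy h p a R))"
proof (rule ennreal_le_epsilon)
  fix e :: real assume e: "0 < e"
  define \<epsilon> where "\<epsilon> = (a / 2 * e / R powr a) powr (1 / p)"
  have \<epsilon>: "0 < \<epsilon>" "\<epsilon> powr p * R powr a = a / 2 * e" using e R p a by (auto simp: \<epsilon>_def powr_powr)
  let ?H = "\<lambda>s. 2 / a * ((\<epsilon> + tail h R s) powr p * s powr a + hardy_const p a * energy h p a s)"
  have "\<exists>D. \<forall>s\<in>{0<..<R}. (?H has_real_derivative D s) (at s) \<and> tail h R s powr p * s powr (a - 1) \<le> D s"
  proof (intro bchoice ballI)
    fix s assume s: "s \<in> {0<..<R}"
    obtain D where D: "((\<lambda>s. (\<epsilon> + tail h R s) powr p * s powr a) has_real_derivative D) (at s)"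
      "a / 2 * ((\<epsilon> + tail h R s) powr p * s powr (a - 1))
        \<le> D + hardy_const p a * (\<bar>h s\<bar> powr p * s powr (a + p - 1))"
      using weighted_tail_deriv[OF \<epsilon>(1) s] by auto
    let ?D = "2 / a * (D + hardy_const p a * (\<bar>h s\<bar> powr p * s powr (a + p - 1)))"
    have "(?H has_real_derivative ?D) (at s)"
      by (intro DERIV_cmult DERIV_add D energy_has_derivative s)
    moreover have "tail h R s powr p * s powr (a - 1) \<le> (\<epsilon> + tail h R s) powr p * s powr (a - 1)"
      using \<epsilon> p tail_nonneg by (intro mult_right_mono powr_mono2) auto
    moreover have "(\<epsilon> + tail h R s) powr p * s powr (a - 1) \<le> ?D"
      using D(2) a by (simp add: field_simps)
    ultimately show "\<exists>D. (?H has_real_derivative D) (at s) \<and> tail h R s powr p * s powr (a - 1) \<le> D"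
      by force
  qed
  then obtain D where D: "\<And>s. s \<in> {0<..<R} \<Longrightarrow> (?H has_real_derivative D s) (at s)"
    "\<And>s. s \<in> {0<..<R} \<Longrightarrow> tail h R s powr p * s powr (a - 1) \<le> D s" by blast
  \<comment> \<open>The integral theorem for nonnegative functions asks for the sign at the two endpoints too.\<close>
  define D0 where "D0 s = (if s \<in> {0<..<R} then D s else 0)" for s
  have "(D0 has_integral ?H R - ?H 0) {0..R}"
  proof (rule fundamental_theorem_of_calculus_interior)
    show "continuous_on {0..R} ?H"
      by (intro continuous_intros continuous_on_weighted_tail continuous_on_energy \<epsilon>)
    show "(?H has_vector_derivative D0 s) (at s)" if "s \<in> {0<..<R}" for s
      using D(1)[OF that] that by (simp add: D0_def has_real_derivative_iff_has_vector_derivative)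
  qed (use R in simp)
  moreover have nonneg: "0 \<le> D0 s" for s
    using D(2)[of s] by (auto simp: D0_def intro: order_trans[rotated])
  ultimately have "(\<integral>\<^sup>+s\<in>{0..R}. ennreal (D0 s) \<partial>lborel) = ennreal (?H R - ?H 0)"
    by (intro nn_integral_has_integral_lebesgue')
  moreover have "(\<integral>\<^sup>+s\<in>{0..R}. ennreal (tail h R s powr p * s powr (a - 1)) \<partial>lborel) \<le>
      (\<integral>\<^sup>+s\<in>{0..R}. ennreal (D0 s) \<partial>lborel)"
  proof (intro nn_integral_mono)
    fix s :: real
    show "ennreal (tail h R s powr p * s powr (a - 1)) * indicator {0..R} s \<le> ennreal (D0 s) * indicator {0..R} s"
    proof (cases "s \<in> {0<..<R}")
      case True
      then show ?thesis using D(2) by (auto simp: D0_def intro!: ennreal_leI)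
    next
      case False
      then have "s = 0 \<or> s = R \<or> s \<notin> {0..R}" by auto
      then show ?thesis by auto
    qed
  qed
  moreover have "?H R - ?H 0 = 2 / a * (hardy_const p a * energy h p a R) + e"
    using \<epsilon> a by (simp add: field_simps)
  ultimately show "(\<integral>\<^sup>+s\<in>{0..R}. ennreal (tail h R s powr p * s powr (a - 1)) \<partial>lborel) \<le>
    ennreal (2 / a * (hardy_const p a * energy h p a R)) + ennreal e"
    using e a hardy_const_pos[OF p a] energy_nonneg[of h p a R] by (simp add: ennreal_plus[symmetric] del: ennreal_plus)
qed

end

section \<open>From radial functions to one variable\<close>

text \<open>
  Restrict \<open>u\<close> to a ray in a fixed direction \<open>e\<close> and let \<open>h\<close> be the derivative there. Radial symmetry makes
  this restriction the same on the ray through any point \<open>x \<noteq> 0\<close>, so \<open>h |x|\<close> is also the derivative of \<open>u\<close> at \<open>x\<close>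
  in the direction \<open>x/|x|\<close> and is bounded by the length of the gradient at \<open>x\<close>.
\<close>

lemma radial_profile:
  fixes u :: "'a::euclidean_space \<Rightarrow> real"
  assumes R: "0 < R"
    and cu: "continuous_on (cball 0 R) u" and cg: "continuous_on (cball 0 R) g"
    and grad: "\<And>x. x \<in> ball 0 R \<Longrightarrow> GDERIV u x :> g x"
    and rad: "radial_on (cball 0 R) u"
    and vanish: "\<And>x. norm x = R \<Longrightarrow> u x = 0"
  obtains h where "continuous_on {0..R} h"
    and "\<And>x. x \<in> ball 0 R \<Longrightarrow> \<bar>h (norm x)\<bar> \<le> norm (grad u x)"
    and "\<And>x. x \<in> cball 0 R \<Longrightarrow> \<bar>u x\<bar> \<le> tail h R (norm x)"
proof -
  obtain e :: 'a where e: "norm e = 1" using norm_Basis nonempty_Basis by blast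
  define h where "h s = g (s *\<^sub>R e) \<bullet> e" for s
  have gradu: "grad u x = g x" if "x \<in> ball 0 R" for x
    using grad_eq[OF grad[OF that]] .
  have ch: "continuous_on {0..R} h"
    unfolding h_def
    by (intro continuous_intros continuous_on_compose2[OF cg]) (auto simp: e)
  have der: "((\<lambda>t. u (t *\<^sub>R w)) has_real_derivative g (s *\<^sub>R w) \<bullet> w) (at s)"
    if "norm w = 1" "\<bar>s\<bar> < R" for w s
  proof -
    have "(u has_derivative (\<lambda>v. v \<bullet> g (s *\<^sub>R w))) (at (s *\<^sub>R w))"
      using grad[of "s *\<^sub>R w"] that by (simp add: gderiv_def)
    moreover have "((\<lambda>t. t *\<^sub>R w) has_derivative (\<lambda>t. t *\<^sub>R w)) (at s)"
      by (intro derivative_eq_intros) auto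
    ultimately have "((\<lambda>t. u (t *\<^sub>R w)) has_derivative (\<lambda>t. (t *\<^sub>R w) \<bullet> g (s *\<^sub>R w))) (at s)"
      by (rule has_derivative_compose[rotated])
    then show ?thesis
      by (simp add: has_field_derivative_def inner_commute mult_commute_abs)
  qed
  have rad': "u x = u y" if "norm x = norm y" "norm x \<le> R" for x y
    using rad that unfolding radial_on_def by (metis mem_cball_0)
  have same: "u (t *\<^sub>R w) = u (t *\<^sub>R e)" if "norm w = 1" "\<bar>t\<bar> \<le> R" for w t
    by (rule rad') (use that e in auto)
  have hle: "\<bar>h (norm x)\<bar> \<le> norm (grad u x)" if x: "x \<in> ball 0 R" for x
  proof -
    define w where "w = (if x = 0 then e else x /\<^sub>R norm x)"
    have w: "norm w = 1" "x = norm x *\<^sub>R w" by (simp_all add: w_def e)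
    have "((\<lambda>t. u (t *\<^sub>R e)) has_real_derivative g (norm x *\<^sub>R w) \<bullet> w) (at (norm x))"
    proof (rule has_field_derivative_transform_within_open[OF der])
      show "open {- R<..<R}" "norm x \<in> {- R<..<R}" using x R by (auto intro: less_le_trans[OF _ norm_ge_zero])
    qed (use w x same in auto)
    moreover have "((\<lambda>t. u (t *\<^sub>R e)) has_real_derivative h (norm x)) (at (norm x))"
      unfolding h_def using x e by (intro der) auto
    ultimately have "h (norm x) = g x \<bullet> w" using w by (metis DERIV_unique)
    then show ?thesis using Cauchy_Schwarz_ineq2[of "g x" w] w gradu[OF x] by simp
  qed
  have ule: "\<bar>u x\<bar> \<le> tail h R (norm x)" if x: "x \<in> cball 0 R" for x
  proof -
    have ux: "u x = u (norm x *\<^sub>R e)" by (rule rad') (use x e in auto)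
    have nonneg: "0 \<le> s" if "norm x \<le> s" for s using norm_ge_zero that by (rule order_trans)
    have "(h has_integral u (R *\<^sub>R e) - u (norm x *\<^sub>R e)) {norm x..R}"
    proof (rule fundamental_theorem_of_calculus_interior)
      show "continuous_on {norm x..R} (\<lambda>t. u (t *\<^sub>R e))"
        by (intro continuous_intros continuous_on_compose2[OF cu])
          (auto simp: e nonneg)
      show "((\<lambda>t. u (t *\<^sub>R e)) has_vector_derivative h s) (at s)" if "s \<in> {norm x<..<R}" for s
      proof -
        have "0 \<le> s" using that by (simp add: nonneg)
        then show ?thesis using der[OF e, of s] that
          by (simp add: h_def has_real_derivative_iff_has_vector_derivative)
      qed
    qed (use x in auto)
    then have "integral {norm x..R} h = - u x"
      using ux vanish[of "R *\<^sub>R e"] e R by (simp add: integral_unique)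
    moreover have "norm (integral {norm x..R} h) \<le> integral {norm x..R} (\<lambda>t. \<bar>h t\<bar>)"
      by (intro integral_norm_bound_integral integrable_continuous_real continuous_intros
          continuous_on_subset[OF ch]) (auto simp: nonneg)
    ultimately show ?thesis by (simp add: tail_def)
  qed
  from that[OF ch hle ule] show thesis .
qed

text \<open>
  Polar coordinates turn the energy of \<open>h\<close> into an integral over a ball, so that integral bounds on the
  gradient (as \<open>W\<close>) become bounds on energies.
\<close>

lemma radial_energy_le:
  fixes W :: "'a::euclidean_space \<Rightarrow> real"
  assumes ch: "continuous_on {0..r} h" and "0 \<le> r" "0 < p" "0 < a + p - 1"
    and le: "\<And>x. x \<in> ball 0 r \<Longrightarrow> \<bar>h (norm x)\<bar> \<le> W x"
  shows "ennreal (unit_sphere_area DIM('a) * energy h p a r) \<le>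
    (\<integral>\<^sup>+x\<in>ball 0 r. ennreal (W x powr p * norm x powr (a + p - real DIM('a))) \<partial>lborel)"
proof -
  let ?n = "real DIM('a)"
  define h0 where "h0 s = indicator {0..r} s *\<^sub>R h s" for s
  have [measurable]: "h0 \<in> borel_measurable borel"
    unfolding h0_def using ch by (intro borel_measurable_continuous_on_indicator) auto
  define \<phi> where "\<phi> s = ennreal (\<bar>h0 s\<bar> powr p * s powr (a + p - ?n)) * indicator {0..<r} s" for s
  have [measurable]: "\<phi> \<in> borel_measurable borel" unfolding \<phi>_def by measurable
  have "continuous_on {0..r} (\<lambda>t. \<bar>h t\<bar> powr p * t powr (a + p - 1))"
    using assms by (intro continuous_intros continuous_on_powr' ch) auto
  then have "((\<lambda>t. \<bar>h t\<bar> powr p * t powr (a + p - 1)) has_integral energy h p a r) {0..r}"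
    unfolding energy_def by (intro integrable_integral integrable_continuous_real)
  then have "ennreal (energy h p a r) =
      (\<integral>\<^sup>+s\<in>{0..r}. ennreal (\<bar>h s\<bar> powr p * s powr (a + p - 1)) \<partial>lborel)"
    by (intro nn_integral_has_integral_lebesgue'[symmetric]) auto
  also have "\<dots> = (\<integral>\<^sup>+s. ennreal (s powr (?n - 1)) * \<phi> s * indicator {0..} s \<partial>lborel)"
  proof (rule nn_integral_cong_AE, use AE_lborel_singleton[of r] in eventually_elim)
    fix s assume "s \<noteq> r"
    then consider "s \<in> {0..<r}" | "s < 0" | "r < s" by fastforce
    then show "ennreal (\<bar>h s\<bar> powr p * s powr (a + p - 1)) * indicator {0..r} s =
        ennreal (s powr (?n - 1)) * \<phi> s * indicator {0..} s"
      by cases (auto simp: \<phi>_def h0_def ennreal_mult[symmetric] powr_add[symmetric] mult.left_commute)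
  qed
  finally have "ennreal (unit_sphere_area DIM('a) * energy h p a r) =
      (\<integral>\<^sup>+x. \<phi> (norm (x::'a)) \<partial>lborel)"
    by (subst nn_integral_radial) (auto simp: ennreal_mult' unit_sphere_area_def)
  also have "\<dots> \<le> (\<integral>\<^sup>+x\<in>ball 0 r. ennreal (W x powr p * norm x powr (a + p - ?n)) \<partial>lborel)"
    using assms by (intro nn_integral_mono)
      (auto simp: \<phi>_def h0_def indicator_def intro!: ennreal_leI mult_right_mono powr_mono2)
  finally show ?thesis .
qed

lemma nn_integral_powr_le_of_radial_decay:
  fixes u :: "'a::euclidean_space \<Rightarrow> real"
  assumes "0 < q" "0 \<le> B" "\<nu> < real DIM('a)" "\<nu> = a * q / p"
    and bound: "\<And>x. x \<in> ball 0 1 \<Longrightarrow> x \<noteq> 0 \<Longrightarrow> \<bar>u x\<bar> powr p * norm x powr a \<le> B" and p: "0 < p"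
  shows "(\<integral>\<^sup>+x\<in>ball 0 1. ennreal (\<bar>u x\<bar> powr q) \<partial>lborel) \<le>
    ennreal (unit_sphere_area DIM('a) / (real DIM('a) - \<nu>) * B powr (q / p))"
proof -
  let ?n = "real DIM('a)"
  have "(\<integral>\<^sup>+x\<in>ball 0 1. ennreal (\<bar>u x\<bar> powr q) \<partial>lborel) \<le>
      (\<integral>\<^sup>+x. ennreal (B powr (q / p)) * (ennreal (norm (x::'a) powr - \<nu>) * indicator (ball 0 1) x) \<partial>lborel)"
  proof (rule nn_integral_mono_AE, use AE_lborel_singleton[of "0::'a"] in eventually_elim)
    fix x :: 'a assume x: "x \<noteq> 0"
    show "ennreal (\<bar>u x\<bar> powr q) * indicator (ball 0 1) x \<le>
      ennreal (B powr (q / p)) * (ennreal (norm x powr - \<nu>) * indicator (ball 0 1) x)"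
    proof (cases "x \<in> ball 0 1")
      case True
      have "\<bar>u x\<bar> powr p \<le> B * norm x powr - a"
        using bound[OF True x] x by (simp add: powr_minus field_simps)
      then have "(\<bar>u x\<bar> powr p) powr (q / p) \<le> (B * norm x powr - a) powr (q / p)"
        using assms by (intro powr_mono2) auto
      then have "\<bar>u x\<bar> powr q \<le> B powr (q / p) * norm x powr - \<nu>"
        using assms by (simp add: powr_mult powr_powr)
      then show ?thesis using True by (simp add: ennreal_mult[symmetric] ennreal_leI)
    qed simp
  qed
  also have "\<dots> = ennreal (B powr (q / p)) * (\<integral>\<^sup>+x\<in>ball (0::'a) 1. ennreal (norm x powr - \<nu>) \<partial>lborel)"
  proof (rule nn_integral_cmult)
    have [measurable]: "ball (0::'a) 1 \<in> sets borel" by simp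
    show "(\<lambda>x::'a. ennreal (norm x powr - \<nu>) * indicator (ball 0 1) x) \<in> borel_measurable lborel"
      by measurable
  qed
  also have "\<dots> \<le> ennreal (B powr (q / p)) *
      ennreal (unit_sphere_area DIM('a) / (?n - \<nu>) * 1 powr (?n - \<nu>))"
    using assms by (intro mult_left_mono nn_integral_norm_powr_ball_0) auto
  finally show ?thesis
    using assms by (simp add: ennreal_mult'[symmetric] mult.commute)
qed

text \<open>
  Let \<open>\<Phi>\<close> be the unweighted energy. The growth condition on \<open>\<Phi>\<close> is the Morrey condition at the origin. It bounds
  the energy of every exponent \<open>\<mu> > \<lambda>\<close>: the product rule gives
  \<open>|h|\<^sup>p s\<^sup>\<mu>\<^sup>-\<^sup>1 = (\<Phi> s\<^sup>\<mu>\<^sup>-\<^sup>n)' + (n - \<mu>) \<Phi> s\<^sup>\<mu>\<^sup>-\<^sup>n\<^sup>-\<^sup>1\<close>, where the last term is at most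
  \<open>(n - \<mu>) A s\<^sup>\<mu>\<^sup>-\<^sup>\<lambda>\<^sup>-\<^sup>1\<close>, a multiple of the derivative of \<open>s\<^sup>\<mu>\<^sup>-\<^sup>\<lambda>\<close>. The function \<open>E\<close> of the proof
  collects the two antiderivatives.
\<close>

lemma morrey_tail_bound:
  assumes ch: "continuous_on {0..1} h" and p: "1 \<le> p" "p < lam" "lam < \<mu>" "\<mu> < n"
    and A: "\<And>s. s \<in> {0<..1} \<Longrightarrow> energy h p (n - p) s \<le> A * s powr (n - lam)"
    and r: "r \<in> {0<..1}"
  shows "tail h 1 r powr p * r powr (\<mu> - p) \<le>
    hardy_const p (\<mu> - p) * (1 + (n - \<mu>) / (\<mu> - lam)) * A"
proof -
  let ?\<Phi> = "energy h p (n - p)"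
  define E where "E s = ?\<Phi> s * s powr (\<mu> - n) + (n - \<mu>) / (\<mu> - lam) * A * s powr (\<mu> - lam)" for s
  have "0 \<le> A" using A[of 1] energy_nonneg[where h = h and p = p and a = "n - p" and s = 1] by simp
  have np: "0 < n - p" using p by simp
  have "continuous_on {r..1} ?\<Phi>"
    by (rule continuous_on_subset[OF continuous_on_energy[OF ch _ p(1) np]]) (use r in auto)
  then have "continuous_on {r..1} E"
    unfolding E_def using r by (intro continuous_intros) auto
  moreover have "\<exists>D. (E has_real_derivative D) (at s) \<and> \<bar>h s\<bar> powr p * s powr (\<mu> - p + p - 1) \<le> D"
    if "s \<in> {r<..<1}" for s
  proof -
    have s: "s \<in> {0<..<1}" "0 < s" using that r by auto
    have dphi: "(?\<Phi> has_real_derivative \<bar>h s\<bar> powr p * s powr (n - 1)) (at s)"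
      using energy_has_derivative[OF ch _ p(1) np s(1)] by simp
    define D where "D = (\<bar>h s\<bar> powr p * s powr (n - 1)) * s powr (\<mu> - n) + ((\<mu> - n) * s powr (\<mu> - n - 1)) * ?\<Phi> s
        + (n - \<mu>) / (\<mu> - lam) * A * ((\<mu> - lam) * s powr (\<mu> - lam - 1))"
    have "(E has_real_derivative D) (at s)"
      unfolding E_def[abs_def] D_def
      by (intro DERIV_add DERIV_mult DERIV_cmult dphi has_real_derivative_powr s)
    moreover have "?\<Phi> s * s powr (\<mu> - n - 1) \<le> A * s powr (\<mu> - lam - 1)"
    proof -
      have "?\<Phi> s * s powr (\<mu> - n - 1) \<le> A * s powr (n - lam) * s powr (\<mu> - n - 1)"
        using A[of s] s by (intro mult_right_mono) auto
      also have "\<dots> = A * s powr (\<mu> - lam - 1)"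
        by (simp add: mult.assoc powr_add[symmetric] algebra_simps)
      finally show ?thesis .
    qed
    then have "(n - \<mu>) * (?\<Phi> s * s powr (\<mu> - n - 1)) \<le> (n - \<mu>) * (A * s powr (\<mu> - lam - 1))"
      using p by (intro mult_left_mono) auto
    moreover have "D = \<bar>h s\<bar> powr p * s powr (\<mu> - p + p - 1)
        - (n - \<mu>) * (?\<Phi> s * s powr (\<mu> - n - 1)) + (n - \<mu>) * (A * s powr (\<mu> - lam - 1))"
    proof -
      have "s powr (n - 1) * s powr (\<mu> - n) = s powr (\<mu> - p + p - 1)"
        by (simp add: powr_add[symmetric])
      then have "(\<bar>h s\<bar> powr p * s powr (n - 1)) * s powr (\<mu> - n) = \<bar>h s\<bar> powr p * s powr (\<mu> - p + p - 1)"
        by simp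
      moreover have "(n - \<mu>) / (\<mu> - lam) * A * ((\<mu> - lam) * s powr (\<mu> - lam - 1)) = (n - \<mu>) * (A * s powr (\<mu> - lam - 1))"
        using p by simp
      moreover have "((\<mu> - n) * s powr (\<mu> - n - 1)) * ?\<Phi> s = - ((n - \<mu>) * (?\<Phi> s * s powr (\<mu> - n - 1)))"
        by (simp add: algebra_simps)
      ultimately show ?thesis unfolding D_def by linarith
    qed
    ultimately have "(E has_real_derivative D) (at s) \<and> \<bar>h s\<bar> powr p * s powr (\<mu> - p + p - 1) \<le> D"
      by linarith
    then show ?thesis by blast
  qed
  ultimately have "tail h 1 r powr p * r powr (\<mu> - p) \<le> hardy_const p (\<mu> - p) * (E 1 - E r)"
    using p r by (intro tail_pointwise_bound[OF ch]) auto
  also have "\<dots> \<le> hardy_const p (\<mu> - p) * ((1 + (n - \<mu>) / (\<mu> - lam)) * A)"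
  proof (intro mult_left_mono)
    have "E 1 \<le> (1 + (n - \<mu>) / (\<mu> - lam)) * A" using A[of 1] by (simp add: E_def distrib_right)
    moreover have "0 \<le> E r" unfolding E_def
      using \<open>0 \<le> A\<close> p energy_nonneg[where h = h and p = p and a = "n - p" and s = r] by simp
    ultimately show "E 1 - E r \<le> (1 + (n - \<mu>) / (\<mu> - lam)) * A" by simp
    show "0 \<le> hardy_const p (\<mu> - p)" using hardy_const_pos[of p "\<mu> - p"] p by simp
  qed
  finally show ?thesis by (simp add: mult.assoc)
qed

section \<open>The embeddings\<close>

text \<open>
  The Morrey norm is evaluated on the balls around the origin. An exponent \<open>\<mu>\<close> strictly between \<open>\<lambda>\<close> and \<open>p + np/q\<close> gives a
  decay of \<open>|u|\<close> whose \<open>q\<close>-th power is integrable at \<open>0\<close>.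
\<close>

theorem radial_morrey_embedding:
  fixes p lam q :: real
  assumes p: "1 \<le> p" "p < lam" "lam < real DIM('a::euclidean_space)"
    and q: "1 \<le> q" "q < real DIM('a) * p / (lam - p)"
  shows "\<exists>C. \<forall>u :: 'a \<Rightarrow> real.
    C1_closure (ball 0 1) u \<and> radial_on (cball 0 1) u \<and> (\<forall>x\<in>sphere 0 1. u x = 0) \<longrightarrow>
    Lq_norm q (ball 0 1) u \<le> ennreal C * grad_morrey_norm p lam (ball 0 1) u"
proof -
  let ?n = "real DIM('a)" and ?\<sigma> = "unit_sphere_area DIM('a)"
  have \<sigma>: "0 < ?\<sigma>" by (intro unit_sphere_area_pos) simp
  have "lam < min ?n (p + ?n * p / q)"
    using p q by (simp add: field_simps)
  from dense[OF this] obtain \<mu> where \<mu>: "lam < \<mu>" "\<mu> < ?n" "\<mu> < p + ?n * p / q" by auto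
  define \<nu> where "\<nu> = (\<mu> - p) * q / p"
  have \<nu>: "\<nu> < ?n" using \<mu> p q by (simp add: \<nu>_def field_simps)
  define K where "K = hardy_const p (\<mu> - p) * (1 + (?n - \<mu>) / (\<mu> - lam)) / ?\<sigma>"
  have K: "0 < K" unfolding K_def using p \<mu> \<sigma>
    by (intro divide_pos_pos mult_pos_pos hardy_const_pos add_pos_nonneg) auto
  define L where "L = ?\<sigma> / (?n - \<nu>) * K powr (q / p)"
  have L: "0 < L" unfolding L_def using \<sigma> \<nu> K by simp
  show ?thesis
  proof (intro exI allI impI, elim conjE)
    fix u :: "'a \<Rightarrow> real"
    assume C1: "C1_closure (ball 0 1) u" and rad: "radial_on (cball 0 1) u"
      and van: "\<forall>x\<in>sphere 0 1. u x = 0"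
    from C1 obtain g where "continuous_on (cball 0 1) u" "continuous_on (cball 0 1) g"
      "\<And>x. x \<in> ball 0 1 \<Longrightarrow> GDERIV u x :> g x" by (auto simp: C1_closure_def)
    then obtain h where h: "continuous_on {0..1} h"
      "\<And>x. x \<in> ball 0 1 \<Longrightarrow> \<bar>h (norm x)\<bar> \<le> norm (grad u x)"
      "\<And>x. x \<in> cball 0 1 \<Longrightarrow> \<bar>u x\<bar> \<le> tail h 1 (norm x)"
      using radial_profile[OF zero_less_one _ _ _ rad] van by (metis mem_sphere_0)
    let ?F = "\<lambda>r y. ennreal (r powr (lam - ?n)) *
      (\<integral>\<^sup>+x\<in>ball 0 1 \<inter> ball y r. ennreal (norm (grad u x) powr p) \<partial>lborel)"
    show "Lq_norm q (ball 0 1) u \<le> ennreal (L powr (1 / q)) * grad_morrey_norm p lam (ball 0 1) u"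
      unfolding Lq_norm_def grad_morrey_norm_def
    proof (rule enn_powr_le_mult)
      fix t assume t: "0 \<le> t" and sup: "(SUP (r, y)\<in>{0<..} \<times> closure (ball 0 1). ?F r y) = ennreal t"
      have energy: "energy h p (?n - p) s \<le> t / ?\<sigma> * s powr (?n - lam)" if s: "s \<in> {0<..1}" for s
      proof -
        have "ennreal (?\<sigma> * energy h p (?n - p) s) \<le>
          (\<integral>\<^sup>+x\<in>ball 0 s. ennreal (norm (grad u x) powr p * norm x powr (?n - p + p - ?n)) \<partial>lborel)"
          using s p h(2) by (intro radial_energy_le continuous_on_subset[OF h(1)]) auto
        also have "\<dots> \<le> (\<integral>\<^sup>+x\<in>ball 0 1 \<inter> ball 0 s. ennreal (norm (grad u x) powr p) \<partial>lborel)"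
          using s by (intro nn_integral_mono) (auto simp: indicator_def)
        finally have "ennreal (s powr (lam - ?n)) * ennreal (?\<sigma> * energy h p (?n - p) s) \<le> ?F s 0"
          by (intro mult_left_mono) auto
        also have "\<dots> \<le> ennreal t"
          unfolding sup[symmetric] using s by (intro SUP_upper2[of "(s, 0)"]) auto
        finally have "s powr (lam - ?n) * (?\<sigma> * energy h p (?n - p) s) \<le> t"
          using t by (simp add: ennreal_mult'[symmetric])
        moreover have "s powr (lam - ?n) * s powr (?n - lam) = 1" using s by (simp add: powr_add[symmetric])
        ultimately show ?thesis using s \<sigma>
          by (simp add: field_simps powr_diff)
      qed
      have "(\<integral>\<^sup>+x\<in>ball 0 1. ennreal (\<bar>u x\<bar> powr q) \<partial>lborel) \<le>
          ennreal (?\<sigma> / (?n - \<nu>) * (K * t) powr (q / p))"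
      proof (rule nn_integral_powr_le_of_radial_decay[OF _ _ \<nu> \<nu>_def])
        fix x :: 'a assume x: "x \<in> ball 0 1" "x \<noteq> 0"
        have "\<bar>u x\<bar> powr p * norm x powr (\<mu> - p) \<le> tail h 1 (norm x) powr p * norm x powr (\<mu> - p)"
          using h(3)[of x] x p by (intro mult_right_mono powr_mono2) auto
        also have "\<dots> \<le> hardy_const p (\<mu> - p) * (1 + (?n - \<mu>) / (\<mu> - lam)) * (t / ?\<sigma>)"
          using x p \<mu> by (intro morrey_tail_bound h(1) energy) auto
        finally show "\<bar>u x\<bar> powr p * norm x powr (\<mu> - p) \<le> K * t" by (simp add: K_def)
      qed (use q p K t in auto)
      also have "?\<sigma> / (?n - \<nu>) * (K * t) powr (q / p) = L * t powr (q / p)"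
        using K t by (simp add: L_def powr_mult)
      finally show "(\<integral>\<^sup>+x\<in>ball 0 1. ennreal (\<bar>u x\<bar> powr q) \<partial>lborel) \<le> ennreal (L * t powr (q / p))" .
    qed (use p q L in auto)
  qed
qed

text \<open>
  The triple norm is evaluated at \<open>y = 0\<close>. With \<open>w\<close> the tail and \<open>a = \<lambda> - p\<close>, the critical exponent is the one with
  \<open>w\<^sup>q s\<^sup>n\<^sup>-\<^sup>1 = (w\<^sup>p s\<^sup>a)\<close> to the power \<open>q/p - 1\<close> times \<open>w\<^sup>p s\<^sup>a\<^sup>-\<^sup>1\<close>: the first factor is bounded, and
  the second is integrable by Hardy's inequality.
\<close>

theorem radial_triple_norm_embedding:
  fixes p lam q :: real
  assumes p: "1 \<le> p" "p < lam" "lam < real DIM('a::euclidean_space)"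
    and q: "q = real DIM('a) * p / (lam - p)"
  shows "\<exists>C. \<forall>u :: 'a \<Rightarrow> real. C1_closure UNIV u \<and> radial_on UNIV u \<and> compact_support u \<longrightarrow>
    Lq_norm q UNIV u \<le> ennreal C * grad_triple_norm p lam UNIV u"
proof -
  let ?n = "real DIM('a)" and ?\<sigma> = "unit_sphere_area DIM('a)"
  have \<sigma>: "0 < ?\<sigma>" by (intro unit_sphere_area_pos) simp
  define a where "a = lam - p"
  have a: "0 < a" "a + p - 1 > 0" using p by (auto simp: a_def)
  have q0: "0 < q" "p \<le> q" using p mult_right_mono[of "lam - p" ?n p] unfolding q by (auto simp: field_simps)
  let ?C = "hardy_const p a"
  have C: "0 < ?C" using p a by (intro hardy_const_pos) auto
  define L where "L = ?\<sigma> * (2 / a) * (?C / ?\<sigma>) powr (q / p)"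
  have L: "0 < L" unfolding L_def using \<sigma> a C by simp
  show ?thesis
  proof (intro exI allI impI, elim conjE)
    fix u :: "'a \<Rightarrow> real"
    assume C1: "C1_closure UNIV u" and rad: "radial_on UNIV u" and "compact_support u"
    then have "bounded (closure {x. u x \<noteq> 0})" by (simp add: compact_support_def compact_imp_bounded)
    then obtain R where R0: "0 < R" "\<forall>x\<in>closure {x. u x \<noteq> 0}. norm x < R"
      unfolding bounded_pos_less by blast
    have R: "0 < R" "\<And>x. u x \<noteq> 0 \<Longrightarrow> norm x < R"
      using R0 closure_subset[of "{x. u x \<noteq> 0}"] by auto
    from C1 obtain g where g: "continuous_on UNIV u" "continuous_on UNIV g"
      "\<And>x. GDERIV u x :> g x" by (auto simp: C1_closure_def)
    have "continuous_on (cball 0 R) u" "continuous_on (cball 0 R) g"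
      using g continuous_on_subset by blast+
    moreover have "radial_on (cball 0 R) u" using rad unfolding radial_on_def by blast
    moreover have "u x = 0" if "norm x = R" for x using R(2)[of x] that by auto
    ultimately obtain h where h: "continuous_on {0..R} h"
      "\<And>x. x \<in> ball 0 R \<Longrightarrow> \<bar>h (norm x)\<bar> \<le> norm (grad u x)"
      "\<And>x. x \<in> cball 0 R \<Longrightarrow> \<bar>u x\<bar> \<le> tail h R (norm x)"
      using radial_profile[OF R(1), of u g] g(3) by metis
    let ?\<tau> = "energy h p a R"
    show "Lq_norm q UNIV u \<le> ennreal (L powr (1 / q)) * grad_triple_norm p lam UNIV u"
      unfolding Lq_norm_def grad_triple_norm_def
    proof (rule enn_powr_le_mult)
      let ?F = "\<lambda>y. \<integral>\<^sup>+x\<in>UNIV. ennreal (norm (grad u x) powr p * norm (x - y) powr (lam - ?n)) \<partial>lborel"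
      fix t assume t: "0 \<le> t" and sup: "(SUP y\<in>closure UNIV. ?F y) = ennreal t"
      have "ennreal (?\<sigma> * ?\<tau>) \<le>
          (\<integral>\<^sup>+x\<in>ball 0 R. ennreal (norm (grad u x) powr p * norm x powr (a + p - ?n)) \<partial>lborel)"
        using h p a R by (intro radial_energy_le) auto
      also have "\<dots> \<le> ?F 0"
        by (intro nn_integral_mono) (auto simp: indicator_def a_def)
      also have "\<dots> \<le> ennreal t" unfolding sup[symmetric] by (intro SUP_upper) auto
      finally have \<tau>: "?\<tau> \<le> t / ?\<sigma>" using t \<sigma> by (simp add: field_simps)
      have \<tau>0: "0 \<le> ?\<tau>" by (rule energy_nonneg)
      define v where "v s = indicator {0..R} s *\<^sub>R tail h R s" for s
      have [measurable]: "v \<in> borel_measurable borel" unfolding v_def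
        by (intro borel_measurable_continuous_on_indicator continuous_on_tail h) auto
      have "(\<integral>\<^sup>+x\<in>UNIV. ennreal (\<bar>u x\<bar> powr q) \<partial>lborel) \<le> (\<integral>\<^sup>+x. ennreal (v (norm (x::'a)) powr q) \<partial>lborel)"
      proof (rule nn_integral_mono)
        fix x :: 'a
        have "\<bar>u x\<bar> \<le> v (norm x)"
        proof (cases "u x = 0")
          case True
          then show ?thesis by (simp add: v_def tail_nonneg)
        next
          case False
          then show ?thesis using h(3)[of x] R(2)[of x] by (simp add: v_def)
        qed
        then show "ennreal (\<bar>u x\<bar> powr q) * indicator UNIV x \<le> ennreal (v (norm x) powr q)"
          using q0 by (auto intro!: ennreal_leI powr_mono2)
      qed
      also have "\<dots> = ennreal ?\<sigma> * (\<integral>\<^sup>+s. ennreal (s powr (?n - 1)) * ennreal (v s powr q) * indicator {0..} s \<partial>lborel)"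
        by (rule nn_integral_radial) simp
      also have "\<dots> \<le> ennreal ?\<sigma> * (\<integral>\<^sup>+s. ennreal ((?C * ?\<tau>) powr (q / p - 1)) *
          (ennreal (v s powr p * s powr (a - 1)) * indicator {0..R} s) \<partial>lborel)"
      proof (intro mult_left_mono nn_integral_mono)
        fix s :: real
        show "ennreal (s powr (?n - 1)) * ennreal (v s powr q) * indicator {0..} s \<le>
          ennreal ((?C * ?\<tau>) powr (q / p - 1)) * (ennreal (v s powr p * s powr (a - 1)) * indicator {0..R} s)"
        proof (cases "s \<in> {0<..R}")
          case True
          let ?w = "tail h R s"
          have w: "0 \<le> ?w" by (rule tail_nonneg)
          have qp: "p * (q / p - 1) = q - p" "a * (q / p - 1) = ?n - a"
            using p a unfolding q a_def by (auto simp: field_simps)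
          have "?w powr p * s powr a \<le> ?C * ?\<tau>"
            using True p a by (intro tail_le_energy h R) auto
          then have "(?w powr p * s powr a) powr (q / p - 1) \<le> (?C * ?\<tau>) powr (q / p - 1)"
            using q0 p by (intro powr_mono2) auto
          then have le: "?w powr (q - p) * s powr (?n - a) \<le> (?C * ?\<tau>) powr (q / p - 1)"
            using w True by (simp add: powr_mult powr_powr qp)
          have "s powr (?n - 1) * ?w powr q = (?w powr (q - p) * s powr (?n - a)) * (?w powr p * s powr (a - 1))"
          proof -
            have "s powr (?n - 1) = s powr (?n - a) * s powr (a - 1)" "?w powr q = ?w powr (q - p) * ?w powr p"
              by (simp_all add: powr_add[symmetric])
            then show ?thesis by (simp only: mult_ac)
          qed
          also have "\<dots> \<le> (?C * ?\<tau>) powr (q / p - 1) * (?w powr p * s powr (a - 1))"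
            using le by (intro mult_right_mono) auto
          finally show ?thesis using True by (simp add: v_def ennreal_mult[symmetric] ennreal_leI)
        next
          case False
          then have "s < 0 \<or> s = 0 \<or> R < s" by auto
          then show ?thesis by (auto simp: v_def)
        qed
      qed simp
      also have "\<dots> = ennreal ?\<sigma> * (ennreal ((?C * ?\<tau>) powr (q / p - 1)) *
          (\<integral>\<^sup>+s\<in>{0..R}. ennreal (v s powr p * s powr (a - 1)) \<partial>lborel))"
        by (subst nn_integral_cmult) auto
      also have "(\<integral>\<^sup>+s\<in>{0..R}. ennreal (v s powr p * s powr (a - 1)) \<partial>lborel) =
          (\<integral>\<^sup>+s\<in>{0..R}. ennreal (tail h R s powr p * s powr (a - 1)) \<partial>lborel)"
        by (intro nn_integral_cong) (auto simp: v_def indicator_def)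
      also have "ennreal ?\<sigma> * (ennreal ((?C * ?\<tau>) powr (q / p - 1)) * \<dots>) \<le>
          ennreal ?\<sigma> * (ennreal ((?C * ?\<tau>) powr (q / p - 1)) * ennreal (2 / a * (?C * ?\<tau>)))"
        by (intro mult_left_mono hardy_inequality h R p a) auto
      also have "\<dots> = ennreal (?\<sigma> * (2 / a) * (?C * ?\<tau>) powr (q / p))"
      proof -
        have "(?C * ?\<tau>) powr (q / p - 1) * (?C * ?\<tau>) = (?C * ?\<tau>) powr (q / p)"
          using C \<tau>0 by (cases "?\<tau> = 0") (auto simp: powr_diff)
        then have "?\<sigma> * ((?C * ?\<tau>) powr (q / p - 1) * (2 / a * (?C * ?\<tau>))) = ?\<sigma> * (2 / a) * (?C * ?\<tau>) powr (q / p)"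
          by (metis mult.assoc mult.left_commute)
        then show ?thesis using C \<sigma> \<tau>0 a by (simp only: ennreal_mult''[symmetric] ennreal_mult'[symmetric] powr_ge_zero less_imp_le)
      qed
      also have "\<dots> \<le> ennreal (L * t powr (q / p))"
      proof (rule ennreal_leI)
        have "(?C * ?\<tau>) powr (q / p) \<le> (?C / ?\<sigma> * t) powr (q / p)"
          using \<tau> C \<tau>0 q0 p \<sigma> mult_left_mono[OF \<tau>, of ?C] by (intro powr_mono2) auto
        also have "\<dots> = (?C / ?\<sigma>) powr (q / p) * t powr (q / p)"
          by (rule powr_mult)
        finally show "?\<sigma> * (2 / a) * (?C * ?\<tau>) powr (q / p) \<le> L * t powr (q / p)"
          unfolding L_def mult.assoc using \<sigma> a by (intro mult_left_mono) auto
      qed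
      finally show "(\<integral>\<^sup>+x\<in>UNIV. ennreal (\<bar>u x\<bar> powr q) \<partial>lborel) \<le> ennreal (L * t powr (q / p))" .
    qed (use p q0 L in auto)
  qed
qed

section \<open>Sharpness of the exponents\<close>

text \<open>
  Test functions are written in terms of \<open>x \<bullet> x\<close> because this is smooth at the origin, whereas \<open>|x|\<close> is not.
\<close>

lemma GDERIV_square_norm_compose:
  assumes "(\<phi> has_real_derivative d) (at (x \<bullet> x))"
  shows "GDERIV (\<lambda>x. \<phi> (x \<bullet> x)) x :> (2 * d) *\<^sub>R x"
proof -
  have "GDERIV (\<lambda>x. x \<bullet> x) x :> 2 *\<^sub>R x"
    unfolding gderiv_def by (auto intro!: derivative_eq_intros simp: inner_commute)
  from GDERIV_DERIV_compose[OF this assms] show ?thesis by (simp add: mult.commute)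
qed

lemma
  fixes \<phi> \<phi>' :: "real \<Rightarrow> real"
  assumes der: "\<And>t. 0 \<le> t \<Longrightarrow> (\<phi> has_real_derivative \<phi>' t) (at t)" and cont: "continuous_on {0..} \<phi>'"
  shows C1_closure_radial: "C1_closure \<Omega> (\<lambda>x::'a::real_inner. \<phi> (x \<bullet> x))"
    and norm_grad_radial: "norm (grad (\<lambda>x::'a. \<phi> (x \<bullet> x)) x) = 2 * \<bar>\<phi>' ((norm x)\<^sup>2)\<bar> * norm x"
    and radial_on_radial: "radial_on \<Omega> (\<lambda>x::'a. \<phi> (x \<bullet> x))"
proof -
  have g: "GDERIV (\<lambda>x::'a. \<phi> (x \<bullet> x)) x :> (2 * \<phi>' (x \<bullet> x)) *\<^sub>R x" for x
    by (intro GDERIV_square_norm_compose der) simp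
  have "continuous_on UNIV (\<lambda>x::'a. \<phi> (x \<bullet> x))"
    using g unfolding gderiv_def continuous_on_eq_continuous_within
    by (blast intro: has_derivative_continuous)
  moreover have "continuous_on UNIV (\<lambda>x::'a. (2 * \<phi>' (x \<bullet> x)) *\<^sub>R x)"
    by (intro continuous_intros continuous_on_compose2[OF cont]) auto
  ultimately show "C1_closure \<Omega> (\<lambda>x::'a. \<phi> (x \<bullet> x))"
    unfolding C1_closure_def using g by (meson continuous_on_subset subset_UNIV)
  show "norm (grad (\<lambda>x::'a. \<phi> (x \<bullet> x)) x) = 2 * \<bar>\<phi>' ((norm x)\<^sup>2)\<bar> * norm x"
    by (simp add: grad_eq[OF g] abs_mult power2_norm_eq_inner)
  show "radial_on \<Omega> (\<lambda>x::'a. \<phi> (x \<bullet> x))"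
    by (simp add: radial_on_def dot_square_norm)
qed

lemma nn_integral_inverse_powr_annulus:
  assumes "0 < r" "r < R"
  shows "(\<integral>\<^sup>+x. ennreal (norm (x::'a::euclidean_space) powr - real DIM('a)) * indicator {r..R} (norm x) \<partial>lborel) =
    ennreal (unit_sphere_area DIM('a) * ln (R / r))"
proof -
  let ?n = "real DIM('a)"
  have "((\<lambda>s. s powr - 1) has_integral ln R - ln r) {r..R}"
    using assms by (intro fundamental_theorem_of_calculus)
      (auto intro!: derivative_eq_intros simp: powr_minus_divide simp flip: has_real_derivative_iff_has_vector_derivative)
  then have I: "(\<integral>\<^sup>+s\<in>{r..R}. ennreal (s powr - 1) \<partial>lborel) = ennreal (ln R - ln r)"
    by (intro nn_integral_has_integral_lebesgue') auto
  have "(\<integral>\<^sup>+x. ennreal (norm (x::'a) powr - ?n) * indicator {r..R} (norm x) \<partial>lborel) =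
    ennreal (unit_sphere_area DIM('a)) * (\<integral>\<^sup>+s. ennreal (s powr (?n - 1)) *
      (ennreal (s powr - ?n) * indicator {r..R} s) * indicator {0..} s \<partial>lborel)"
    by (rule nn_integral_radial) auto
  also have "(\<integral>\<^sup>+s. ennreal (s powr (?n - 1)) * (ennreal (s powr - ?n) * indicator {r..R} s) * indicator {0..} s \<partial>lborel)
      = (\<integral>\<^sup>+s\<in>{r..R}. ennreal (s powr - 1) \<partial>lborel)"
    using assms by (intro nn_integral_cong) (auto simp: indicator_def ennreal_mult[symmetric] powr_add[symmetric])
  finally show ?thesis
    using assms unfolding I by (simp add: ennreal_mult[symmetric] unit_sphere_area_def ln_div)
qed

text \<open>
  What a hypothetical embedding constant \<open>C\<close> would say about a single test function. The maximum is needed since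
  \<open>ennreal C = 0\<close> for negative \<open>C\<close>.
\<close>

lemma enn_powr_lower_bound_of_embedding:
  assumes "enn_powr X (1 / q) \<le> ennreal C * enn_powr Y (1 / p)" "0 < q" "0 < p" "0 \<le> T"
    and "ennreal L \<le> X" and "Y \<le> ennreal T"
  shows "L \<le> (max C 0 * T powr (1 / p)) powr q"
proof -
  have "enn_powr X (1 / q) \<le> ennreal C * enn_powr (ennreal T) (1 / p)"
    using assms by (auto intro!: order_trans[OF assms(1)] mult_left_mono enn_powr_mono)
  also have "\<dots> = ennreal (max C 0 * T powr (1 / p))"
    using assms by (simp add: enn_powr_ennreal ennreal_mult' max_def ennreal_neg)
  finally have "X \<le> ennreal ((max C 0 * T powr (1 / p)) powr q)"
    by (subst (asm) enn_powr_le_iff) (use assms in auto)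
  with assms(5) have "ennreal L \<le> ennreal ((max C 0 * T powr (1 / p)) powr q)" by (rule order_trans)
  then show ?thesis by (simp add: ennreal_le_iff)
qed

text \<open>
  With \<open>\<beta> = (\<lambda>-p)/p\<close>, the test functions approximate \<open>|x|\<^sup>-\<^sup>\<beta> - 1\<close> from below, and their gradients have
  uniformly bounded Morrey norm because \<open>(\<beta> + 1) p = \<lambda>\<close>. As \<open>\<beta> q \<ge> n\<close>, on the annulus \<open>\<epsilon> \<le> |x| \<le> \<delta>\<close>
  their \<open>q\<close>-th powers are bounded below by a multiple of \<open>|x|\<^sup>-\<^sup>n\<close>, whose integral \<open>ln (\<delta>/\<epsilon>)\<close> is unbounded.
\<close>

theorem radial_morrey_embedding_sharp:
  fixes p lam q :: real
  assumes p: "1 \<le> p" "p < lam" "lam < real DIM('a::euclidean_space)"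
    and q: "real DIM('a) * p / (lam - p) \<le> q"
  shows "\<not> (\<exists>C. \<forall>u :: 'a \<Rightarrow> real.
    C1_closure (ball 0 1) u \<and> radial_on (cball 0 1) u \<and> (\<forall>x\<in>sphere 0 1. u x = 0) \<longrightarrow>
    Lq_norm q (ball 0 1) u \<le> ennreal C * grad_morrey_norm p lam (ball 0 1) u)"
proof
  let ?n = "real DIM('a)" and ?\<sigma> = "unit_sphere_area DIM('a)"
  have \<sigma>: "0 < ?\<sigma>" by (intro unit_sphere_area_pos) simp
  assume "\<exists>C. \<forall>u :: 'a \<Rightarrow> real.
    C1_closure (ball 0 1) u \<and> radial_on (cball 0 1) u \<and> (\<forall>x\<in>sphere 0 1. u x = 0) \<longrightarrow>
    Lq_norm q (ball 0 1) u \<le> ennreal C * grad_morrey_norm p lam (ball 0 1) u"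
  then obtain C where C: "\<And>u :: 'a \<Rightarrow> real. C1_closure (ball 0 1) u \<Longrightarrow> radial_on (cball 0 1) u \<Longrightarrow>
    (\<forall>x\<in>sphere 0 1. u x = 0) \<Longrightarrow> Lq_norm q (ball 0 1) u \<le> ennreal C * grad_morrey_norm p lam (ball 0 1) u"
    by blast
  define \<beta> where "\<beta> = (lam - p) / p"
  have \<beta>: "0 < \<beta>" "(\<beta> + 1) * p = lam" using p by (auto simp: \<beta>_def field_simps)
  have q0: "0 < q" using q p by (intro less_le_trans[OF _ q] divide_pos_pos mult_pos_pos) auto
  have \<beta>q: "?n \<le> \<beta> * q" using p q by (simp add: \<beta>_def field_simps)
  \<comment> \<open>On the annulus \<open>|x|\<^sup>2 + \<epsilon>\<^sup>2 \<le> 2 |x|\<^sup>2\<close>, so the main term is at least \<open>2 \<kappa> |x|\<^sup>-\<^sup>\<beta>\<close>; half of it absorbs the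
     subtracted constant as soon as \<open>|x|\<^sup>\<beta> \<le> \<kappa>\<close>, which is the choice of \<open>\<delta>\<close>.\<close>
  define \<kappa> where "\<kappa> = 2 powr (- \<beta> / 2) / 2"
  have "2 powr (- \<beta> / 2) \<le> 2 powr (0::real)" using \<beta> by (intro powr_mono) auto
  then have \<kappa>: "0 < \<kappa>" "\<kappa> < 1" by (auto simp: \<kappa>_def)
  define \<delta> where "\<delta> = \<kappa> powr (1 / \<beta>)"
  have \<delta>: "0 < \<delta>" "\<delta> < 1" "\<delta> powr \<beta> = \<kappa>"
    using \<kappa> \<beta> powr_less_mono2[of "1 / \<beta>" \<kappa> 1] by (auto simp: \<delta>_def powr_powr)
  define T where "T = \<beta> powr p * riesz_const DIM('a) lam"
  have T: "0 \<le> T" using riesz_const_pos[of lam "DIM('a)"] p by (simp add: T_def)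
  define D where "D = (max C 0 * T powr (1 / p)) powr q"
  have bound: "\<kappa> powr q * (?\<sigma> * ln (\<delta> / \<epsilon>)) \<le> D" if \<epsilon>: "0 < \<epsilon>" "\<epsilon> < \<delta>" for \<epsilon>
  proof -
    define \<phi> where "\<phi> t = (t + \<epsilon>\<^sup>2) powr (- \<beta> / 2) - (1 + \<epsilon>\<^sup>2) powr (- \<beta> / 2)" for t
    define \<phi>' where "\<phi>' t = - \<beta> / 2 * (t + \<epsilon>\<^sup>2) powr (- \<beta> / 2 - 1)" for t
    define u where "u = (\<lambda>x::'a. \<phi> (x \<bullet> x))"
    have pos: "0 < t + \<epsilon>\<^sup>2" if "0 \<le> t" for t using that \<epsilon> by (simp add: add_nonneg_pos)
    have der: "(\<phi> has_real_derivative \<phi>' t) (at t)" if "0 \<le> t" for t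
      unfolding \<phi>_def[abs_def] \<phi>'_def using pos[OF that]
      by (auto intro!: derivative_eq_intros simp: powr_diff)
    have cont: "continuous_on {0..} \<phi>'"
      unfolding \<phi>'_def[abs_def] using pos by (intro continuous_intros) force+
    have ng: "norm (grad u x) = 2 * \<bar>\<phi>' ((norm x)\<^sup>2)\<bar> * norm x" for x
      unfolding u_def by (rule norm_grad_radial[OF der cont])
    have gradu: "norm (grad u x) powr p \<le> \<beta> powr p * norm x powr - lam" for x
    proof (cases "x = 0")
      case True
      then show ?thesis unfolding ng by simp
    next
      case False
      have "((norm x)\<^sup>2 + \<epsilon>\<^sup>2) powr (- \<beta> / 2 - 1) \<le> ((norm x)\<^sup>2) powr (- \<beta> / 2 - 1)"
        using False \<epsilon> \<beta> by (intro powr_mono2') auto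
      also have "\<dots> = norm x powr (- \<beta> - 2)"
        using False by (simp add: powr_powr algebra_simps flip: powr_numeral)
      finally have "norm (grad u x) \<le> \<beta> * norm x powr (- \<beta> - 2) * norm x"
        unfolding ng using \<beta>
        by (simp add: \<phi>'_def abs_mult mult_right_mono mult_left_mono)
      also have "\<dots> = \<beta> * norm x powr (- \<beta> - 1)" using False by (simp add: powr_diff field_simps power2_eq_square)
      finally have "norm (grad u x) powr p \<le> (\<beta> * norm x powr (- \<beta> - 1)) powr p"
        using p by (intro powr_mono2) auto
      also have "\<dots> = \<beta> powr p * norm x powr ((- \<beta> - 1) * p)" by (simp add: powr_mult powr_powr)
      also have "(- \<beta> - 1) * p = - lam" using \<beta>(2) by (simp add: algebra_simps)
      finally show ?thesis .
    qed
    have Y: "(SUP (r, y)\<in>{0<..} \<times> closure (ball 0 1). ennreal (r powr (lam - ?n)) *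
      (\<integral>\<^sup>+x\<in>ball 0 1 \<inter> ball y r. ennreal (norm (grad u x) powr p) \<partial>lborel)) \<le> ennreal T"
    proof (intro SUP_least, clarify)
      fix r :: real and y :: 'a assume "0 < r"
      have [measurable]: "ball y r \<in> sets borel" by simp
      have "(\<integral>\<^sup>+x\<in>ball 0 1 \<inter> ball y r. ennreal (norm (grad u x) powr p) \<partial>lborel) \<le>
        (\<integral>\<^sup>+x. ennreal (\<beta> powr p) * (ennreal (norm x powr - lam) * indicator (ball y r) x) \<partial>lborel)"
        using gradu by (intro nn_integral_mono) (auto simp: indicator_def ennreal_mult[symmetric] ennreal_leI)
      also have "\<dots> = ennreal (\<beta> powr p) * (\<integral>\<^sup>+x\<in>ball y r. ennreal (norm x powr - lam) \<partial>lborel)"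
        by (rule nn_integral_cmult) measurable
      also have "\<dots> \<le> ennreal (\<beta> powr p) * ennreal (riesz_const DIM('a) lam * r powr (?n - lam))"
        using p \<open>0 < r\<close> by (intro mult_left_mono nn_integral_norm_powr_ball) auto
      finally have "ennreal (r powr (lam - ?n)) *
          (\<integral>\<^sup>+x\<in>ball 0 1 \<inter> ball y r. ennreal (norm (grad u x) powr p) \<partial>lborel) \<le>
        ennreal (r powr (lam - ?n)) * (ennreal (\<beta> powr p) * ennreal (riesz_const DIM('a) lam * r powr (?n - lam)))"
        by (intro mult_left_mono) auto
      also have "\<dots> = ennreal (r powr (lam - ?n) * (\<beta> powr p * (riesz_const DIM('a) lam * r powr (?n - lam))))"
        by (simp add: ennreal_mult')
      also have "r powr (lam - ?n) * (\<beta> powr p * (riesz_const DIM('a) lam * r powr (?n - lam))) = T"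
      proof -
        have "r powr (lam - ?n) * r powr (?n - lam) = 1" using \<open>0 < r\<close> by (simp add: powr_add[symmetric])
        then show ?thesis by (simp add: T_def mult.left_commute)
      qed
      finally show "ennreal (r powr (lam - ?n)) *
          (\<integral>\<^sup>+x\<in>ball 0 1 \<inter> ball y r. ennreal (norm (grad u x) powr p) \<partial>lborel) \<le> ennreal T" .
    qed
    have lower: "\<kappa> powr q * s powr - ?n \<le> \<bar>\<phi> (s\<^sup>2)\<bar> powr q" if s: "s \<in> {\<epsilon>..\<delta>}" for s
    proof -
      have s0: "0 < s" "s \<le> 1" using s \<epsilon> \<delta> by auto
      have "\<epsilon>\<^sup>2 \<le> s\<^sup>2" using s \<epsilon> by (intro power_mono) auto
      then have "(2 * s\<^sup>2) powr (- \<beta> / 2) \<le> (s\<^sup>2 + \<epsilon>\<^sup>2) powr (- \<beta> / 2)"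
        using s0 \<epsilon> \<beta> by (intro powr_mono2') (auto intro: add_pos_pos)
      moreover have "(2 * s\<^sup>2) powr (- \<beta> / 2) = 2 * \<kappa> * s powr - \<beta>"
        using s0 by (simp add: \<kappa>_def powr_mult powr_powr flip: powr_numeral)
      moreover have "(1 + \<epsilon>\<^sup>2) powr (- \<beta> / 2) \<le> 1 powr (- \<beta> / 2)"
        using \<beta> by (intro powr_mono2') auto
      moreover have "1 \<le> \<kappa> * s powr - \<beta>"
      proof -
        have "s powr \<beta> \<le> \<kappa>" using s s0 \<beta> powr_mono2[of \<beta> s \<delta>] \<delta>(3) by simp
        then show ?thesis using s0 by (simp add: powr_minus field_simps)
      qed
      ultimately have "\<kappa> * s powr - \<beta> \<le> \<bar>\<phi> (s\<^sup>2)\<bar>" by (simp add: \<phi>_def)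
      then have "(\<kappa> * s powr - \<beta>) powr q \<le> \<bar>\<phi> (s\<^sup>2)\<bar> powr q"
        using \<kappa> q0 by (intro powr_mono2) auto
      moreover have "(\<kappa> * s powr - \<beta>) powr q = \<kappa> powr q * s powr - (\<beta> * q)"
        by (simp add: powr_mult powr_powr)
      moreover have "s powr - ?n \<le> s powr - (\<beta> * q)" using s0 \<beta>q by (intro powr_mono') auto
      then have "\<kappa> powr q * s powr - ?n \<le> \<kappa> powr q * s powr - (\<beta> * q)" by (intro mult_left_mono) auto
      ultimately show ?thesis by linarith
    qed
    have "ennreal (\<kappa> powr q * (?\<sigma> * ln (\<delta> / \<epsilon>))) = ennreal (\<kappa> powr q) *
      (\<integral>\<^sup>+x. ennreal (norm (x::'a) powr - ?n) * indicator {\<epsilon>..\<delta>} (norm x) \<partial>lborel)"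
      using \<epsilon> by (simp add: nn_integral_inverse_powr_annulus ennreal_mult')
    also have "\<dots> = (\<integral>\<^sup>+x. ennreal (\<kappa> powr q) * (ennreal (norm (x::'a) powr - ?n) * indicator {\<epsilon>..\<delta>} (norm x)) \<partial>lborel)"
      by (rule nn_integral_cmult[symmetric]) measurable
    also have "\<dots> \<le> (\<integral>\<^sup>+x\<in>ball 0 1. ennreal (\<bar>u x\<bar> powr q) \<partial>lborel)"
      using lower \<delta> by (intro nn_integral_mono)
        (auto simp: indicator_def u_def ennreal_mult[symmetric] dot_square_norm intro!: ennreal_leI)
    finally have X: "ennreal (\<kappa> powr q * (?\<sigma> * ln (\<delta> / \<epsilon>))) \<le> (\<integral>\<^sup>+x\<in>ball 0 1. ennreal (\<bar>u x\<bar> powr q) \<partial>lborel)" .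
    have "\<forall>x\<in>sphere 0 1. u x = 0" by (simp add: u_def \<phi>_def dot_square_norm)
    with C[of u] have "Lq_norm q (ball 0 1) u \<le> ennreal C * grad_morrey_norm p lam (ball 0 1) u"
      unfolding u_def using C1_closure_radial[OF der cont] radial_on_radial[OF der cont] by blast
    then show ?thesis
      unfolding D_def Lq_norm_def grad_morrey_norm_def
      by (rule enn_powr_lower_bound_of_embedding[OF _ q0 _ T X Y]) (use p in simp)
  qed
  \<comment> \<open>Chosen so that \<open>ln (\<delta>/\<epsilon>)\<close> exceeds by one what the upper bound permits.\<close>
  define \<epsilon> where "\<epsilon> = \<delta> * exp (- (D / (\<kappa> powr q * ?\<sigma>) + 1))"
  have "0 \<le> D" by (simp add: D_def)
  have "0 < D / (\<kappa> powr q * ?\<sigma>) + 1" using \<kappa> \<sigma> \<open>0 \<le> D\<close> by (simp add: add_nonneg_pos)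
  then have "0 < \<epsilon>" "\<epsilon> < \<delta>" using \<delta> by (auto simp: \<epsilon>_def)
  moreover have "\<delta> / \<epsilon> = exp (D / (\<kappa> powr q * ?\<sigma>) + 1)"
    using \<delta>(1) unfolding \<epsilon>_def exp_minus by (simp add: divide_inverse)
  then have "ln (\<delta> / \<epsilon>) = D / (\<kappa> powr q * ?\<sigma>) + 1" by (simp only: ln_exp)
  ultimately have "\<kappa> powr q * (?\<sigma> * (D / (\<kappa> powr q * ?\<sigma>) + 1)) \<le> D" using bound[of \<epsilon>] by simp
  moreover have "\<kappa> powr q * (?\<sigma> * (D / (\<kappa> powr q * ?\<sigma>) + 1)) = D + \<kappa> powr q * ?\<sigma>"
    using \<kappa> \<sigma> by (simp add: field_simps)
  moreover have "0 < \<kappa> powr q * ?\<sigma>" using \<kappa> \<sigma> by simp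
  ultimately show False by linarith
qed

lemma has_real_derivative_square_max_0:
  "((\<lambda>s. (max 0 s)\<^sup>2) has_real_derivative 2 * max 0 s) (at (s::real))"
proof -
  consider "0 < s" | "s < 0" | "s = 0" by linarith
  then show ?thesis
  proof cases
    case 1
    have "((\<lambda>s. s\<^sup>2) has_real_derivative 2 * max 0 s) (at s)"
      using 1 by (auto intro!: derivative_eq_intros)
    then show ?thesis by (rule has_field_derivative_transform_within_open[of _ _ _ "{0<..}"]) (use 1 in auto)
  next
    case 2
    have "((\<lambda>s. 0) has_real_derivative 2 * max 0 s) (at s)" using 2 by auto
    then show ?thesis by (rule has_field_derivative_transform_within_open[of _ _ _ "{..<0}"]) (use 2 in auto)
  next
    case 3
    have "(max 0 h)\<^sup>2 / h = max 0 h" for h :: real by (auto simp: max_def power2_eq_square)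
    moreover have "((\<lambda>h. max 0 h) \<longlongrightarrow> max 0 0) (at (0::real))" by (intro tendsto_intros)
    ultimately show ?thesis using 3 by (simp add: DERIV_def)
  qed
qed

lemma nn_integral_ball_translate:
  fixes c :: "'a::euclidean_space"
  assumes [measurable]: "f \<in> borel_measurable borel"
  shows "(\<integral>\<^sup>+x\<in>ball 0 r. f (x - c) \<partial>lborel) = (\<integral>\<^sup>+x\<in>ball (- c) r. f x \<partial>lborel)"
proof -
  have [measurable]: "ball (0::'a) r \<in> sets borel" by simp
  have "(\<integral>\<^sup>+x\<in>ball 0 r. f (x - c) \<partial>lborel) =
      (\<integral>\<^sup>+x. f (x - c) * indicator (ball 0 r) x \<partial>distr lborel borel ((+) c))"
    by (simp only: lborel_distr_plus)
  also have "\<dots> = (\<integral>\<^sup>+x. f (c + x - c) * indicator (ball 0 r) (c + x) \<partial>lborel)"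
    by (rule nn_integral_distr) measurable
  also have "\<dots> = (\<integral>\<^sup>+x\<in>ball (- c) r. f x \<partial>lborel)"
    by (intro nn_integral_cong) (auto simp: indicator_def dist_norm norm_minus_commute add.commute)
  finally show ?thesis .
qed

text \<open>
  The test functions are the dilations of the \<open>C\<^sup>1\<close> bump \<open>(max 0 (1 - |x|\<^sup>2))\<^sup>2\<close> to radius \<open>R\<close>. Their gradients are at
  most \<open>4/R\<close> and are supported in a ball of radius \<open>R\<close>, over which the weight has integral at most
  \<open>C R\<^sup>\<lambda>\<close> wherever it is centred. An embedding would thus bound \<open>R\<^sup>n\<close> by a multiple of \<open>R\<^sup>\<beta>\<^sup>q\<close>, which fails as
  \<open>R \<rightarrow> 0\<close> because \<open>\<beta> q > n\<close>.
\<close>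

theorem radial_triple_norm_embedding_sharp:
  fixes p lam q :: real
  assumes p: "1 \<le> p" "p < lam" "lam < real DIM('a::euclidean_space)"
    and q: "real DIM('a) * p / (lam - p) < q"
  shows "\<not> (\<exists>C. \<forall>u :: 'a \<Rightarrow> real. C1_closure UNIV u \<and> radial_on UNIV u \<and> compact_support u \<longrightarrow>
    Lq_norm q UNIV u \<le> ennreal C * grad_triple_norm p lam UNIV u)"
proof
  let ?n = "real DIM('a)" and ?\<omega> = "unit_ball_vol (real DIM('a))"
  assume "\<exists>C. \<forall>u :: 'a \<Rightarrow> real. C1_closure UNIV u \<and> radial_on UNIV u \<and> compact_support u \<longrightarrow>
    Lq_norm q UNIV u \<le> ennreal C * grad_triple_norm p lam UNIV u"
  then obtain C where C: "\<And>u :: 'a \<Rightarrow> real. C1_closure UNIV u \<Longrightarrow> radial_on UNIV u \<Longrightarrow> compact_support u \<Longrightarrow>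
    Lq_norm q UNIV u \<le> ennreal C * grad_triple_norm p lam UNIV u" by blast
  define \<beta> where "\<beta> = (lam - p) / p"
  have q0: "0 < q" using q p by (intro less_trans[OF _ q] divide_pos_pos mult_pos_pos) auto
  have \<beta>q: "?n < \<beta> * q" using p q by (simp add: \<beta>_def field_simps)
  define K where "K = 4 powr p * riesz_const DIM('a) (?n - lam)"
  have K: "0 \<le> K" using riesz_const_pos[of "?n - lam" "DIM('a)"] p by (simp add: K_def)
  define D where "D = (max C 0 * K powr (1 / p)) powr q"
  define c where "c = (9 / 16) powr q * (?\<omega> * (1 / 2) ^ DIM('a))"
  have c: "0 < c" by (simp add: c_def)
  have bound: "c \<le> D * R powr (\<beta> * q - ?n)" if R: "0 < R" for R
  proof -
    define \<phi> where "\<phi> t = (max 0 (1 - t / R\<^sup>2))\<^sup>2" for t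
    define \<phi>' where "\<phi>' t = 2 * max 0 (1 - t / R\<^sup>2) * (- 1 / R\<^sup>2)" for t
    define u where "u = (\<lambda>x::'a. \<phi> (x \<bullet> x))"
    have der: "(\<phi> has_real_derivative \<phi>' t) (at t)" for t
    proof -
      have "((\<lambda>t. 1 - t / R\<^sup>2) has_real_derivative - 1 / R\<^sup>2) (at t)"
        using DERIV_diff[OF DERIV_const[of 1] DERIV_cdivide[OF DERIV_ident, where c = "R\<^sup>2"]] by simp
      from DERIV_chain2[OF has_real_derivative_square_max_0 this]
      show ?thesis unfolding \<phi>_def[abs_def] \<phi>'_def .
    qed
    have cont: "continuous_on {0..} \<phi>'"
      unfolding \<phi>'_def[abs_def] using R by (intro continuous_intros) auto
    have outside: "1 - (norm x)\<^sup>2 / R\<^sup>2 \<le> 0" if "x \<notin> ball 0 R" for x :: 'a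
      using that R power_mono[of R "norm x" 2] by (simp add: field_simps)
    have ng: "norm (grad u x) = 2 * \<bar>\<phi>' ((norm x)\<^sup>2)\<bar> * norm x" for x
      unfolding u_def by (rule norm_grad_radial[OF der cont])
    have gradu: "norm (grad u x) powr p \<le> (4 / R) powr p * indicator (ball 0 R) x" for x
    proof (cases "x \<in> ball 0 R")
      case True
      have "max 0 (1 - (norm x)\<^sup>2 / R\<^sup>2) \<le> 1" by simp
      moreover have "norm x \<le> R" using True by simp
      ultimately have "max 0 (1 - (norm x)\<^sup>2 / R\<^sup>2) * norm x \<le> 1 * R" by (intro mult_mono) auto
      then have "4 / R\<^sup>2 * (max 0 (1 - (norm x)\<^sup>2 / R\<^sup>2) * norm x) \<le> 4 / R\<^sup>2 * (1 * R)"
        by (intro mult_left_mono) auto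
      then have "norm (grad u x) \<le> 4 / R"
        unfolding ng using R
        by (simp add: \<phi>'_def abs_mult power2_eq_square)
      then show ?thesis using True p by (auto intro!: powr_mono2)
    next
      case False
      then show ?thesis using outside[OF False]
        unfolding ng by (simp add: \<phi>'_def)
    qed
    have Y: "(SUP y\<in>closure UNIV. \<integral>\<^sup>+x\<in>UNIV. ennreal (norm (grad u x) powr p * norm (x - y) powr (lam - ?n)) \<partial>lborel)
      \<le> ennreal (K * R powr (lam - p))"
    proof (rule SUP_least)
      fix y :: 'a
      have [measurable]: "ball (0::'a) R \<in> sets borel" by simp
      have "(\<integral>\<^sup>+x\<in>UNIV. ennreal (norm (grad u x) powr p * norm (x - y) powr (lam - ?n)) \<partial>lborel) \<le>
        (\<integral>\<^sup>+x. ennreal ((4 / R) powr p) * (ennreal (norm (x - y) powr - (?n - lam)) * indicator (ball 0 R) x) \<partial>lborel)"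
      proof (rule nn_integral_mono)
        fix x :: 'a
        have "norm (grad u x) powr p * norm (x - y) powr (lam - ?n) \<le>
          (4 / R) powr p * indicator (ball 0 R) x * norm (x - y) powr (lam - ?n)"
          by (intro mult_right_mono gradu) auto
        then show "ennreal (norm (grad u x) powr p * norm (x - y) powr (lam - ?n)) * indicator UNIV x \<le>
          ennreal ((4 / R) powr p) * (ennreal (norm (x - y) powr - (?n - lam)) * indicator (ball 0 R) x)"
          using gradu[of x] by (cases "x \<in> ball 0 R") (auto simp: ennreal_mult[symmetric] intro!: ennreal_leI)
      qed
      also have "\<dots> = ennreal ((4 / R) powr p) * (\<integral>\<^sup>+x\<in>ball 0 R. ennreal (norm (x - y) powr - (?n - lam)) \<partial>lborel)"
        by (rule nn_integral_cmult) measurable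
      also have "\<dots> = ennreal ((4 / R) powr p) * (\<integral>\<^sup>+x\<in>ball (- y) R. ennreal (norm x powr - (?n - lam)) \<partial>lborel)"
        by (subst nn_integral_ball_translate) auto
      also have "\<dots> \<le> ennreal ((4 / R) powr p) * ennreal (riesz_const DIM('a) (?n - lam) * R powr (?n - (?n - lam)))"
        using p R by (intro mult_left_mono nn_integral_norm_powr_ball) auto
      also have "\<dots> = ennreal (K * R powr (lam - p))"
        using R by (simp add: K_def ennreal_mult'[symmetric] powr_divide powr_diff mult_ac)
      finally show "(\<integral>\<^sup>+x\<in>UNIV. ennreal (norm (grad u x) powr p * norm (x - y) powr (lam - ?n)) \<partial>lborel) \<le>
        ennreal (K * R powr (lam - p))" .
    qed
    have lower: "(9 / 16) powr q \<le> \<bar>u x\<bar> powr q" if "x \<in> ball 0 (R / 2)" for x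
    proof -
      have "(norm x)\<^sup>2 \<le> (R / 2)\<^sup>2" using that by (intro power_mono) auto
      then have "3 / 4 \<le> 1 - (norm x)\<^sup>2 / R\<^sup>2" using R by (simp add: field_simps power2_eq_square)
      then have "3 / 4 \<le> max 0 (1 - (norm x)\<^sup>2 / R\<^sup>2)" by (rule max.coboundedI2)
      then have "(3 / 4)\<^sup>2 \<le> u x" unfolding u_def \<phi>_def dot_square_norm by (rule power_mono) simp
      then show ?thesis using q0 by (intro powr_mono2) (auto simp: power2_eq_square)
    qed
    have "ennreal (c * R powr ?n) = ennreal ((9 / 16) powr q) * emeasure lborel (ball (0::'a) (R / 2))"
      using R by (simp add: c_def emeasure_ball ennreal_mult'[symmetric] powr_realpow power_divide)
    also have "\<dots> = (\<integral>\<^sup>+x\<in>ball (0::'a) (R / 2). ennreal ((9 / 16) powr q) \<partial>lborel)"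
      by (subst nn_integral_cmult_indicator) auto
    also have "\<dots> \<le> (\<integral>\<^sup>+x\<in>UNIV. ennreal (\<bar>u x\<bar> powr q) \<partial>lborel)"
      using lower by (intro nn_integral_mono) (auto simp: indicator_def intro!: ennreal_leI)
    finally have X: "ennreal (c * R powr ?n) \<le> (\<integral>\<^sup>+x\<in>UNIV. ennreal (\<bar>u x\<bar> powr q) \<partial>lborel)" .
    have "{x. u x \<noteq> 0} \<subseteq> ball 0 R"
    proof (rule subsetI, rule ccontr)
      fix x assume "x \<in> {x. u x \<noteq> 0}" "x \<notin> ball 0 R"
      with outside[of x] show False by (simp add: u_def \<phi>_def dot_square_norm)
    qed
    then have "compact_support u"
      unfolding compact_support_def compact_closure by (rule bounded_subset[OF bounded_ball])
    with C[of u] have "Lq_norm q UNIV u \<le> ennreal C * grad_triple_norm p lam UNIV u"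
      unfolding u_def using C1_closure_radial[OF der cont] radial_on_radial[OF der cont] by blast
    then have "c * R powr ?n \<le> (max C 0 * (K * R powr (lam - p)) powr (1 / p)) powr q"
      unfolding Lq_norm_def grad_triple_norm_def
      by (rule enn_powr_lower_bound_of_embedding[OF _ q0 _ _ X Y]) (use p K in auto)
    also have "\<dots> = D * R powr (\<beta> * q)"
      using K by (simp add: D_def \<beta>_def powr_mult powr_powr)
    finally have "c * R powr ?n * R powr - ?n \<le> D * R powr (\<beta> * q) * R powr - ?n"
      by (intro mult_right_mono) auto
    then show ?thesis using R by (simp add: mult.assoc powr_add[symmetric])
  qed
  define \<gamma> where "\<gamma> = \<beta> * q - ?n"
  have \<gamma>: "0 < \<gamma>" using \<beta>q by (simp add: \<gamma>_def)
  \<comment> \<open>So small that \<open>D R\<^sup>\<gamma> < c\<close>; the summand \<open>1\<close> allows for \<open>D = 0\<close>.\<close>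
  define R where "R = (c / (D + 1)) powr (1 / \<gamma>)"
  have D: "0 \<le> D" by (simp add: D_def)
  have "0 < R" "R powr \<gamma> = c / (D + 1)" using c D \<gamma> by (auto simp: R_def powr_powr)
  with bound[of R] have "c \<le> D * (c / (D + 1))" by (simp add: \<gamma>_def)
  then show False using c D by (simp add: field_simps)
qed

section \<open>The radial embedding theorem\<close>

theorem theorem1p5:
  fixes p lam p\<^sub>2 :: real
  assumes "1 \<le> p" and "p < lam" and "lam < real CARD('n::finite)"
    and "p\<^sub>2 = real CARD('n) * p / (lam - p)"
  shows
    "(\<forall>q. 1 \<le> q \<and> q < p\<^sub>2 \<longrightarrow>
       (\<exists>C::real. \<forall>u :: real ^ 'n \<Rightarrow> real.
          C1_closure (ball 0 1) u \<and> radial_on (cball 0 1) u \<and> (\<forall>x\<in>sphere 0 1. u x = 0) \<longrightarrow>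
          Lq_norm q (ball 0 1) u \<le> ennreal C * grad_morrey_norm p lam (ball 0 1) u)) \<and>
     (\<forall>q. q \<ge> p\<^sub>2 \<longrightarrow>
       \<not> (\<exists>C::real. \<forall>u :: real ^ 'n \<Rightarrow> real.
          C1_closure (ball 0 1) u \<and> radial_on (cball 0 1) u \<and> (\<forall>x\<in>sphere 0 1. u x = 0) \<longrightarrow>
          Lq_norm q (ball 0 1) u \<le> ennreal C * grad_morrey_norm p lam (ball 0 1) u)) \<and>
     (\<exists>C::real. \<forall>u :: real ^ 'n \<Rightarrow> real.
          C1_closure UNIV u \<and> radial_on UNIV u \<and> compact_support u \<longrightarrow>
          Lq_norm p\<^sub>2 UNIV u \<le> ennreal C * grad_triple_norm p lam UNIV u) \<and>
     (\<forall>q. q > p\<^sub>2 \<longrightarrow>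
       \<not> (\<exists>C::real. \<forall>u :: real ^ 'n \<Rightarrow> real.
          C1_closure UNIV u \<and> radial_on UNIV u \<and> compact_support u \<longrightarrow>
          Lq_norm q UNIV u \<le> ennreal C * grad_triple_norm p lam UNIV u))"
  using radial_morrey_embedding[where 'a = "real ^ 'n", of p lam]
    radial_morrey_embedding_sharp[where 'a = "real ^ 'n", of p lam]
    radial_triple_norm_embedding[where 'a = "real ^ 'n", of p lam p\<^sub>2]
    radial_triple_norm_embedding_sharp[where 'a = "real ^ 'n", of p lam] assms
  by (intro conjI allI impI) (simp_all add: DIM_cart)

end
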